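(* Let $p(n)$ denote the number of partitions of $n$. For all integers $n>m>1$, \[ p(n)^2 - p(n-m)\,p(n+m) > 0. \]
   Context: $p(n)$ is the partition function: the number of ways of writing $n$ as an unordered sum of positive integers. *)

theory Defs
  imports Main "HOL-Library.Multiset"
begin

definition partitions :: "nat \<Rightarrow> nat multiset set" where
  "partitions n = {M. (\<forall>x \<in># M. x > 0) \<and> sum_mset M = n}"

definition part :: "nat \<Rightarrow> nat" where
  "part n = card (partitions n)"

end

theory Submission
  imports Defs "HOL-Analysis.Gamma_Function"
begin

text \<open>
  Strict log-concavity of the partition function \<open>p\<close> at every \<open>n \<ge> 26\<close> means that the ratios
  \<open>p(k+1)/p(k)\<close> decrease from \<open>k = 25\<close> on; as the earlier ratios all exceed the one at \<open>26\<close>, comparing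
  the ratios over the blocks \<open>[n-m, n)\<close> and \<open>[n, n+m)\<close> gives the theorem for \<open>n \<ge> 26\<close>, and finitely
  many cases remain.

  For large \<open>n\<close>, put \<open>q(k) = c(k) r^k\<close>, where \<open>c(k)\<close> counts the partitions of \<open>k\<close> into parts at most \<open>M\<close>
  and \<open>M\<close> is huge. By the inequality of arithmetic and geometric means, \<open>q(n) > (q(n-1) + q(n+1))/2\<close>
  suffices, for any \<open>r\<close>. By Fourier inversion this says that the integral over \<open>[0, \<pi>]\<close> of
  \<open>Re(f(r e^{ia}) e^{-ina}) (1 - cos a)\<close> is positive, where \<open>f(z) = \<Prod>1/(1 - z^j)\<close>. With \<open>r = e^{-t}\<close>
  chosen at the saddle point, \<open>f(r e^{ia}) e^{-ina}\<close> is \<open>f(r) e^{-R(a)} e^{i\<phi>(a)}\<close> with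
  \<open>R(a) \<le> (\<pi>^2/6) a^2/t^3\<close> and \<open>\<phi>(a) = O(a^3/t^4)\<close>, so the part near \<open>a = 0\<close> is positive; lower bounds
  for \<open>R\<close> from the first two terms of the logarithmic series show that it dominates. This covers
  \<open>n \<ge> 1481\<close>; smaller \<open>n\<close> are checked by computing \<open>p\<close> with Euler's pentagonal recurrence.
\<close>

section \<open>Partitions with bounded parts\<close>

definition restricted_partitions :: "nat \<Rightarrow> nat \<Rightarrow> nat multiset set" where
  "restricted_partitions M n = {A. set_mset A \<subseteq> {1..M} \<and> sum_mset A = n}"

definition rpart :: "nat \<Rightarrow> nat \<Rightarrow> nat" where
  "rpart M n = card (restricted_partitions M n)"

lemma member_le_sum_mset:
  fixes A :: "nat multiset"
  assumes "x \<in># A"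
  shows "x \<le> sum_mset A"
  using assms by (metis le_add1 multi_member_split sum_mset.add_mset)

lemma restricted_partitions_Suc:
  "restricted_partitions (Suc M) n = restricted_partitions M n \<union>
     (if Suc M \<le> n then add_mset (Suc M) ` restricted_partitions (Suc M) (n - Suc M) else {})"
  (is "?L = ?R")
proof
  show "?L \<subseteq> ?R"
  proof
    fix A assume A: "A \<in> ?L"
    show "A \<in> ?R"
    proof (cases "Suc M \<in># A")
      case True
      then obtain B where B: "A = add_mset (Suc M) B" by (meson multi_member_split)
      with A have "Suc M \<le> n" "B \<in> restricted_partitions (Suc M) (n - Suc M)"
        by (auto simp: restricted_partitions_def)
      with B show ?thesis by auto
    next
      case False
      then have "A \<in> restricted_partitions M n" using A
        by (auto simp: restricted_partitions_def)
          (metis atLeastAtMost_iff le_SucE subsetD One_nat_def)+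
      then show ?thesis by auto
    qed
  qed
  show "?R \<subseteq> ?L"
    by (auto simp: restricted_partitions_def split: if_splits)
qed

lemma restricted_partitions_0: "restricted_partitions 0 n = (if n = 0 then {{#}} else {})"
  by (auto simp: restricted_partitions_def)

lemma finite_restricted_partitions: "finite (restricted_partitions M n)"
proof (induction M arbitrary: n)
  case 0
  then show ?case by (simp add: restricted_partitions_0)
next
  case (Suc M)
  note IH = Suc
  show ?case
  proof (induction n rule: less_induct)
    case (less n)
    show ?case
      using IH less by (subst restricted_partitions_Suc) auto
  qed
qed

lemma rpart_0: "rpart 0 n = (if n = 0 then 1 else 0)"
  by (simp add: rpart_def restricted_partitions_0)

lemma rpart_Suc:
  "rpart (Suc M) n = rpart M n + (if Suc M \<le> n then rpart (Suc M) (n - Suc M) else 0)"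
proof -
  let ?B = "add_mset (Suc M) ` restricted_partitions (Suc M) (n - Suc M)"
  have "A \<notin> ?B" if "A \<in> restricted_partitions M n" for A
  proof
    assume "A \<in> ?B"
    then have "Suc M \<in># A" by auto
    with that have "Suc M \<in> {1..M}" unfolding restricted_partitions_def by blast
    then show False by simp
  qed
  then have "restricted_partitions M n \<inter> ?B = {}"
    by blast
  then have "card (restricted_partitions M n \<union> ?B) = card (restricted_partitions M n) + card ?B"
    by (intro card_Un_disjoint finite_imageI finite_restricted_partitions)
  also have "card ?B = rpart (Suc M) (n - Suc M)"
    unfolding rpart_def by (rule card_image) (simp add: inj_on_def)
  finally have "card (restricted_partitions M n \<union> ?B) = rpart M n + rpart (Suc M) (n - Suc M)"
    unfolding rpart_def .
  moreover have "rpart (Suc M) n = card (restricted_partitions M n \<union>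
     (if Suc M \<le> n then add_mset (Suc M) ` restricted_partitions (Suc M) (n - Suc M) else {}))"
    unfolding rpart_def using restricted_partitions_Suc[of M n] by (rule arg_cong)
  ultimately show ?thesis by (simp add: rpart_def)
qed

lemma restricted_partitions_eq_partitions:
  assumes "n \<le> M"
  shows "restricted_partitions M n = partitions n"
  using assms by (fastforce simp: restricted_partitions_def partitions_def Suc_le_eq
      dest: member_le_sum_mset)

lemma rpart_eq_part: "n \<le> M \<Longrightarrow> rpart M n = part n"
  by (simp add: rpart_def part_def restricted_partitions_eq_partitions)

lemma rpart_at_0: "rpart M 0 = 1"
  by (induction M) (simp_all add: rpart_0 rpart_Suc)

text \<open>Induction on \<open>M\<close>: by \<open>rpart_Suc\<close> the series for
  \<open>Suc M\<close> is the one for \<open>M\<close> plus \<open>z ^ Suc M\<close> times itself,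
  which amounts to dividing by \<open>1 - z ^ Suc M\<close>. Convergence has to come first, before
  this equation may be solved.\<close>

lemma rpart_sums:
  fixes z :: complex
  assumes "norm z < 1"
  shows "summable (\<lambda>n. real (rpart M n) * norm z ^ n)"
    and "(\<lambda>n. of_nat (rpart M n) * z ^ n) sums (\<Prod>j=1..M. 1 / (1 - z ^ j))"
proof -
  let ?r = "norm z"
  have *: "summable (\<lambda>n. real (rpart M n) * ?r ^ n) \<and>
    (\<lambda>n. of_nat (rpart M n) * z ^ n) sums (\<Prod>j=1..M. 1 / (1 - z ^ j))"
  proof (induction M)
    case 0
    have "(\<lambda>n. of_nat (rpart 0 n) * z ^ n) = (\<lambda>n. if n = 0 then 1 else 0)"
      and "(\<lambda>n. real (rpart 0 n) * ?r ^ n) = (\<lambda>n. if n = 0 then 1 else 0)"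
      by (auto simp: rpart_0)
    then show ?case using sums_single[of 0 "\<lambda>_. 1::complex"] sums_single[of 0 "\<lambda>_. 1::real"]
      by (simp add: sums_iff)
  next
    case (Suc M)
    let ?f = "\<lambda>n. real (rpart (Suc M) n) * ?r ^ n"
    define S where "S = (\<Sum>n. real (rpart M n) * ?r ^ n)"
    have r: "0 \<le> ?r ^ Suc M" "?r ^ Suc M < 1"
      using assms by (simp_all add: power_less_one_iff del: power_Suc)
    have rec: "?f n = real (rpart M n) * ?r ^ n +
        (if Suc M \<le> n then ?r ^ Suc M * ?f (n - Suc M) else 0)" for n
      by (subst rpart_Suc) (auto simp: algebra_simps simp flip: power_add power_Suc)
    \<comment> \<open>A partial sum is at most \<open>S\<close> plus \<open>?r ^ Suc M\<close> times
      itself, since the shifted sum has fewer terms; solving for it gives a bound independent of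
      \<open>N\<close>.\<close>
    have bound: "sum ?f {..<N} \<le> S / (1 - ?r ^ Suc M)" for N
    proof -
      have "(\<Sum>n<N. if Suc M \<le> n then ?r ^ Suc M * ?f (n - Suc M) else 0)
          = (\<Sum>n\<in>{Suc M..<N}. ?r ^ Suc M * ?f (n - Suc M))"
        by (rule sum.mono_neutral_cong_right) auto
      also have "\<dots> = (\<Sum>n\<in>{..<N - Suc M}. ?r ^ Suc M * ?f n)"
        by (rule sum.reindex_bij_witness[of _ "\<lambda>n. n + Suc M" "\<lambda>n. n - Suc M"]) auto
      also have "\<dots> \<le> (\<Sum>n\<in>{..<N}. ?r ^ Suc M * ?f n)"
        by (rule sum_mono2) auto
      also have "\<dots> = ?r ^ Suc M * sum ?f {..<N}"
        by (simp only: sum_distrib_left)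
      finally have "sum ?f {..<N} \<le> (\<Sum>n<N. real (rpart M n) * ?r ^ n) + ?r ^ Suc M * sum ?f {..<N}"
        by (subst (1) rec) (simp add: sum.distrib)
      also have "(\<Sum>n<N. real (rpart M n) * ?r ^ n) \<le> S"
        unfolding S_def using Suc by (intro sum_le_suminf) auto
      finally show ?thesis using r by (simp add: field_simps)
    qed
    have summ: "summable ?f"
      by (rule summableI_nonneg_bounded[OF _ bound]) simp
    let ?g = "\<lambda>n. of_nat (rpart (Suc M) n) * z ^ n"
    have grec: "?g n = of_nat (rpart M n) * z ^ n +
        (if Suc M \<le> n then z ^ Suc M * ?g (n - Suc M) else 0)" for n
      by (subst rpart_Suc) (auto simp: algebra_simps simp flip: power_add power_Suc)
    have "summable ?g"
      by (rule summable_norm_cancel) (use summ in \<open>simp add: norm_mult norm_power\<close>)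
    then have g: "?g sums suminf ?g" by blast
    have "(\<lambda>n. z ^ Suc M * ?g n) sums (z ^ Suc M * suminf ?g)"
      using g by (rule sums_mult)
    then have "(\<lambda>n. if Suc M \<le> n then z ^ Suc M * ?g (n - Suc M) else 0) sums (z ^ Suc M * suminf ?g)"
      by (subst sums_iff_shift'[of _ "Suc M", symmetric]) (simp cong: if_cong)
    with Suc have "(\<lambda>n. of_nat (rpart M n) * z ^ n + (if Suc M \<le> n then z ^ Suc M * ?g (n - Suc M) else 0))
       sums ((\<Prod>j=1..M. 1 / (1 - z ^ j)) + z ^ Suc M * suminf ?g)"
      by (intro sums_add) auto
    also have "(\<lambda>n. of_nat (rpart M n) * z ^ n + (if Suc M \<le> n then z ^ Suc M * ?g (n - Suc M) else 0)) = ?g"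
      by (rule ext, rule grec[symmetric])
    finally have "suminf ?g = (\<Prod>j=1..M. 1 / (1 - z ^ j)) + z ^ Suc M * suminf ?g"
      using g by (simp only: sums_unique2)
    moreover have "1 - z ^ Suc M \<noteq> 0"
      using r(2) by (metis eq_iff_diff_eq_0 less_irrefl norm_one norm_power)
    ultimately have "suminf ?g = (\<Prod>j=1..M. 1 / (1 - z ^ j)) / (1 - z ^ Suc M)"
      by (metis (no_types, lifting) add_diff_cancel_right' mult.commute mult_1 nonzero_eq_divide_eq right_diff_distrib)
    then have "suminf ?g = (\<Prod>j=1..Suc M. 1 / (1 - z ^ j))"
      by (simp only: prod.nat_ivl_Suc') simp
    with g summ show ?case by simp
  qed
  then show "summable (\<lambda>n. real (rpart M n) * norm z ^ n)"
    and "(\<lambda>n. of_nat (rpart M n) * z ^ n) sums (\<Prod>j=1..M. 1 / (1 - z ^ j))"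
    by auto
qed

section \<open>The pentagonal recurrence and small arguments\<close>

text \<open>
  D. Shanks' finite form of Euler's pentagonal number theorem: modulo \<open>x ^ (n + 1)\<close> only the
  summand \<open>s = 0\<close> survives on the left.
\<close>

lemma shanks_identity:
  fixes x :: "'a :: comm_ring_1"
  shows "(\<Sum>s\<le>n. (-1) ^ s * (\<Prod>j=Suc s..n. 1 - x ^ j) * x ^ (s * n + s * Suc s div 2)) =
         1 + (\<Sum>s=1..n. (-1) ^ s * (x ^ (s * (3 * s - 1) div 2) + x ^ (s * (3 * s + 1) div 2)))"
proof (induction n)
  case 0
  show ?case by simp
next
  case (Suc n)
  define Q where "Q s m = (\<Prod>j=Suc s..m. 1 - x ^ j)" for s m
  define T where "T s = s * Suc s div 2" for s :: nat
  have T_Suc: "T (Suc s) = T s + Suc s" for s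
    by (simp add: T_def)
  have Q_Suc: "Q s (Suc n) = Q s n * (1 - x ^ Suc n)" if "s \<le> n" for s
    using that by (simp add: Q_def)
  have Q_step: "(1 - x ^ Suc s) * Q (Suc s) n = Q s n" if "Suc s \<le> n" for s
    unfolding Q_def using that by (subst (2) prod.atLeast_Suc_atMost) auto
  have Q_refl: "Q s s = 1" for s
    by (simp add: Q_def)
  have aux1: "a * q * (y * e) = a * q * e - a * ((1 - y) * q) * e"
    and aux2: "a * (q * (1 - y)) * e = a * q * e - a * q * (y * e)" for a q y e :: 'a
    by (simp_all add: algebra_simps)
  let ?A = "\<lambda>n. \<Sum>s\<le>n. (-1) ^ s * Q s n * x ^ (s * n + T s)"
  let ?B = "\<lambda>s. (-1) ^ s * Q s n * x ^ (Suc s * Suc n + T s)"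
  \<comment> \<open>Raising \<open>n\<close> in the exponent brings in
    \<open>x ^ s = 1 - (1 - x ^ s)\<close>; as \<open>1 - x ^ s\<close> completes
    \<open>Q s n\<close> to \<open>Q (s - 1) n\<close>, the correction is the sum of
    \<open>?B s\<close> over \<open>s < n\<close>. The new factor of \<open>Q s (Suc n)\<close>
    subtracts \<open>?B s\<close> for all \<open>s \<le> n\<close>, so only \<open>?B n\<close>
    survives.\<close>
  have "(\<Sum>s\<le>n. (-1) ^ s * Q s n * x ^ (s * Suc n + T s)) =
        (\<Sum>s\<le>n. (-1) ^ s * Q s n * x ^ (s * n + T s)) -
        (\<Sum>s\<le>n. (-1) ^ s * ((1 - x ^ s) * Q s n) * x ^ (s * n + T s))"
    unfolding sum_subtractf[symmetric]
  proof (rule sum.cong[OF refl])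
    fix s
    have "x ^ (s * Suc n + T s) = x ^ s * x ^ (s * n + T s)"
      by (simp add: add.assoc flip: power_add)
    then show "(-1) ^ s * Q s n * x ^ (s * Suc n + T s) =
        (-1) ^ s * Q s n * x ^ (s * n + T s) - (-1) ^ s * ((1 - x ^ s) * Q s n) * x ^ (s * n + T s)"
      by (simp only: aux1)
  qed
  also have "(\<Sum>s\<le>n. (-1) ^ s * ((1 - x ^ s) * Q s n) * x ^ (s * n + T s)) =
     (\<Sum>s<n. (-1) ^ Suc s * ((1 - x ^ Suc s) * Q (Suc s) n) * x ^ (Suc s * n + T (Suc s)))"
    by (subst sum.atMost_shift) simp
  also have "\<dots> = - (\<Sum>s<n. ?B s)"
    unfolding sum_negf[symmetric]
  proof (rule sum.cong[OF refl])
    fix s assume "s \<in> {..<n}"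
    then have "(1 - x ^ Suc s) * Q (Suc s) n = Q s n"
      by (intro Q_step) simp
    moreover have "Suc s * n + T (Suc s) = Suc s * Suc n + T s"
      by (simp add: T_Suc)
    ultimately show "(-1) ^ Suc s * ((1 - x ^ Suc s) * Q (Suc s) n) * x ^ (Suc s * n + T (Suc s)) = - ?B s"
      by (simp only: power_Suc mult_minus_left mult_1_left)
  qed
  finally have 1: "(\<Sum>s\<le>n. (-1) ^ s * Q s n * x ^ (s * Suc n + T s)) = ?A n + (\<Sum>s<n. ?B s)"
    by simp
  have "?A (Suc n) = (\<Sum>s\<le>n. (-1) ^ s * Q s (Suc n) * x ^ (s * Suc n + T s)) +
      (-1) ^ Suc n * x ^ (Suc n * Suc n + T (Suc n))"
    by (simp add: Q_refl)
  also have "(\<Sum>s\<le>n. (-1) ^ s * Q s (Suc n) * x ^ (s * Suc n + T s)) =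
     (\<Sum>s\<le>n. (-1) ^ s * Q s n * x ^ (s * Suc n + T s)) - (\<Sum>s\<le>n. ?B s)"
    unfolding sum_subtractf[symmetric]
  proof (rule sum.cong[OF refl])
    fix s assume "s \<in> {..n}"
    then have "Q s (Suc n) = Q s n * (1 - x ^ Suc n)"
      by (intro Q_Suc) simp
    moreover have "x ^ (Suc s * Suc n + T s) = x ^ Suc n * x ^ (s * Suc n + T s)"
      by (simp only: mult_Suc power_add mult.assoc)
    ultimately show "(-1) ^ s * Q s (Suc n) * x ^ (s * Suc n + T s) =
        (-1) ^ s * Q s n * x ^ (s * Suc n + T s) - ?B s"
      by (simp only: aux2)
  qed
  also have "\<dots> = ?A n - ?B n"
    unfolding 1 by (simp add: lessThan_Suc_atMost[symmetric])
  finally have 2: "?A (Suc n) = ?A n + (-1) ^ Suc n * (x ^ (Suc n * Suc n + T n) + x ^ (Suc n * Suc n + T (Suc n)))"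
    by (simp add: Q_refl algebra_simps)
  \<comment> \<open>The two leftover exponents are the generalised pentagonal numbers of index
    \<open>Suc n\<close>.\<close>
  have e1: "Suc n * Suc n + T n = Suc n * (3 * Suc n - 1) div 2"
  proof -
    have "Suc n * (3 * Suc n - 1) = 2 * (Suc n * Suc n) + n * Suc n" by (simp add: algebra_simps)
    then show ?thesis unfolding T_def by simp
  qed
  have e2: "Suc n * Suc n + T (Suc n) = Suc n * (3 * Suc n + 1) div 2"
  proof -
    have "Suc n * (3 * Suc n + 1) = 2 * (Suc n * Suc n) + Suc n * Suc (Suc n)" by (simp add: algebra_simps)
    then show ?thesis unfolding T_def by simp
  qed
  have "?A n = 1 + (\<Sum>s=1..n. (-1) ^ s * (x ^ (s * (3 * s - 1) div 2) + x ^ (s * (3 * s + 1) div 2)))"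
    using Suc unfolding Q_def T_def .
  with 2 have "?A (Suc n) = 1 + (\<Sum>s=1..Suc n. (-1) ^ s * (x ^ (s * (3 * s - 1) div 2) + x ^ (s * (3 * s + 1) div 2)))"
    unfolding e1 e2 by (simp add: algebra_simps)
  then show ?case unfolding Q_def T_def .
qed

definition rpart_fps :: "nat \<Rightarrow> int fps" where
  "rpart_fps M = Abs_fps (\<lambda>n. int (rpart M n))"

lemma rpart_fps_mult: "rpart_fps M * (\<Prod>j=1..M. 1 - fps_X ^ j) = 1"
proof (induction M)
  case 0
  show ?case by (rule fps_ext) (simp add: rpart_fps_def rpart_0)
next
  case (Suc M)
  have "rpart_fps (Suc M) * (1 - fps_X ^ Suc M) = rpart_fps M"
    by (rule fps_ext, simp only: right_diff_distrib fps_sub_nth fps_X_power_mult_right_nth)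
       (auto simp: rpart_fps_def rpart_Suc[of M] not_le)
  then have "rpart_fps (Suc M) * ((1 - fps_X ^ Suc M) * (\<Prod>j=1..M. 1 - fps_X ^ j)) = 1"
    using Suc by (simp only: mult.assoc[symmetric])
  moreover have "(\<Prod>j=1..Suc M. 1 - fps_X ^ j) = (1 - fps_X ^ Suc M) * (\<Prod>j=1..M. 1 - fps_X ^ j :: int fps)"
    by (subst prod.nat_ivl_Suc') simp_all
  ultimately show ?case by (simp only:)
qed

text \<open>Multiply \<open>shanks_identity\<close> at \<open>x = X\<close> by the generating
  function of partitions into parts at most \<open>k\<close>, and compare coefficients of
  \<open>X ^ n\<close>. The product with \<open>c 0\<close> is 1, whose coefficient vanishes as
  \<open>0 < n\<close>; since \<open>n \<le> k\<close>, the coefficients involved are values of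
  p.\<close>

lemma pentagonal_recurrence:
  assumes "0 < n" and "n \<le> k"
  shows "int (part n) = (\<Sum>s=1..k. (-1) ^ (s + 1) *
     ((if s * (3 * s - 1) div 2 \<le> n then int (part (n - s * (3 * s - 1) div 2)) else 0) +
      (if s * (3 * s + 1) div 2 \<le> n then int (part (n - s * (3 * s + 1) div 2)) else 0)))"
proof -
  let ?F = "rpart_fps k" and ?X = "fps_X :: int fps"
  define c where "c s = (\<Prod>j=Suc s..k. 1 - ?X ^ j)" for s
  let ?e = "\<lambda>s. s * k + s * Suc s div 2"
  have "(\<Sum>s\<le>k. (-1) ^ s * c s * ?X ^ ?e s) = c 0 + (\<Sum>s=1..k. (-1) ^ s * c s * ?X ^ ?e s)"
    by (simp add: atMost_atLeast0 sum.atLeast_Suc_atMost)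
  then have id: "c 0 = 1 + (\<Sum>s=1..k. (-1) ^ s * (?X ^ (s * (3 * s - 1) div 2) + ?X ^ (s * (3 * s + 1) div 2)))
      - (\<Sum>s=1..k. (-1) ^ s * c s * ?X ^ ?e s)"
    using shanks_identity[where x = ?X and n = k] unfolding c_def by (simp add: algebra_simps)
  have pw: "(-1) ^ s * f = fps_const ((-1) ^ s) * f" for s and f :: "int fps"
    by (cases "even s") (simp_all flip: fps_const_neg)
  \<comment> \<open>For \<open>s \<ge> 1\<close> the exponent is at least \<open>k + 1\<close>,
    hence beyond \<open>n\<close>.\<close>
  have small: "fps_nth (?F * ((-1) ^ s * c s * ?X ^ ?e s)) n = 0" if "s \<in> {1..k}" for s
  proof -
    have "s * k \<ge> k" "s * Suc s \<ge> 2"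
      using that mult_le_mono[of 1 s 2 "Suc s"] by auto
    then have "n < ?e s" using assms div_le_mono[of 2 "s * Suc s" 2] by linarith
    then show ?thesis by (simp only: mult.assoc[symmetric] fps_X_power_mult_right_nth) simp
  qed
  have Fk: "fps_nth (?F * ((-1) ^ s * ?X ^ e)) n = (-1) ^ s * (if e \<le> n then int (part (n - e)) else 0)" for s e
  proof -
    have eq: "?F * ((-1) ^ s * ?X ^ e) = fps_const ((-1) ^ s) * (?F * ?X ^ e)"
      by (simp only: pw mult.left_commute)
    show ?thesis
      unfolding eq fps_mult_left_const_nth fps_X_power_mult_right_nth
      using assms by (simp add: rpart_fps_def rpart_eq_part)
  qed
  have F: "fps_nth ?F n = int (part n)"
    using assms by (simp add: rpart_fps_def rpart_eq_part)
  have "0 = fps_nth (1 :: int fps) n" using assms by simp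
  also have "(1 :: int fps) = ?F * c 0"
    using rpart_fps_mult[of k] by (simp add: c_def)
  also have "fps_nth (?F * c 0) n = int (part n) + (\<Sum>s=1..k. (-1) ^ s *
     ((if s * (3 * s - 1) div 2 \<le> n then int (part (n - s * (3 * s - 1) div 2)) else 0) +
      (if s * (3 * s + 1) div 2 \<le> n then int (part (n - s * (3 * s + 1) div 2)) else 0)))"
    unfolding id using assms small F
    by (simp add: right_diff_distrib distrib_left sum_distrib_left fps_sum_nth Fk cong: if_cong)
  finally have 0: "int (part n) = - (\<Sum>s=1..k. (-1) ^ s *
     ((if s * (3 * s - 1) div 2 \<le> n then int (part (n - s * (3 * s - 1) div 2)) else 0) +
      (if s * (3 * s + 1) div 2 \<le> n then int (part (n - s * (3 * s + 1) div 2)) else 0)))"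
    by linarith
  show ?thesis
    by (subst 0, unfold sum_negf[symmetric]) (rule sum.cong, simp_all)
qed

text \<open>
  The recurrence in a form that the simplifier can execute. A list holds \<open>p(n), p(n-1), \<dots>, p(0)\<close>; the
  generalised pentagonal numbers have the alternating gaps \<open>s\<close> and \<open>2s + 1\<close>, so \<open>psum\<close> and \<open>psum'\<close>
  walk down the list by these gaps.
\<close>

fun chop :: "nat \<Rightarrow> 'a list \<Rightarrow> 'a list" where
  "chop 0 xs = xs"
| "chop (Suc n) [] = []"
| "chop (Suc n) (x # xs) = chop n xs"

text \<open>Every rewrite step traverses the whole remaining list, hence the long strides.\<close>

lemma chop_stride [code]:
  "chop 0 xs = xs"
  "chop (Suc n) [] = []"
  "chop (Suc 0) (x # xs) = xs"
  "chop (Suc (Suc n)) [x] = []"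
  "chop (Suc (Suc 0)) (x # y # xs) = xs"
  "chop (Suc (Suc (Suc n))) [x, y] = []"
  "chop (Suc (Suc (Suc 0))) (x # y # z # xs) = xs"
  "chop (Suc (Suc (Suc (Suc n)))) [x, y, z] = []"
  "chop (Suc (Suc (Suc (Suc 0)))) (x # y # z # w # xs) = xs"
  "chop (Suc (Suc (Suc (Suc (Suc n))))) [x, y, z, w] = []"
  "chop (Suc (Suc (Suc (Suc (Suc 0))))) (x # y # z # w # a # xs) = xs"
  "chop (Suc (Suc (Suc (Suc (Suc (Suc n)))))) [x, y, z, w, a] = []"
  "chop (Suc (Suc (Suc (Suc (Suc (Suc n)))))) (x # y # z # w # a # b # xs) = chop n xs"
  by simp_all

lemma chop_eq_drop: "chop n xs = drop n xs"
  by (induction n xs rule: chop.induct) auto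

text \<open>The gap \<open>2 * s + 1\<close> is taken by dropping the head and then chopping
  \<open>s\<close> twice, so the only arithmetic on \<open>s\<close> is \<open>Suc\<close>. The
  subtraction in \<open>psum'\<close> produces the alternating signs.\<close>

function psum :: "nat \<Rightarrow> int list \<Rightarrow> int" and psum' :: "nat \<Rightarrow> int list \<Rightarrow> int" where
  "psum s [] = 0"
| "psum s (x # xs) = x + psum' s (chop s (x # xs))"
| "psum' s [] = 0"
| "psum' s (y # ys) = y - psum (Suc s) (chop s (chop s ys))"
  by pat_completeness auto
text \<open>For \<open>s = 0\<close> the call from \<open>psum\<close> to \<open>psum'\<close> keeps
  the whole list; the extra 1 in the measure makes it decrease all the same.\<close>

termination
  by (relation "Wellfounded.measure (\<lambda>x. case x of Inl (s, xs) \<Rightarrow> 2 * length xs + 1 | Inr (s, xs) \<Rightarrow> 2 * length xs)")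
    (auto simp: chop_eq_drop)

fun ptable :: "nat \<Rightarrow> int list \<Rightarrow> int list" where
  "ptable 0 L = L"
| "ptable (Suc n) L = ptable n (psum 1 L # L)"

text \<open>Dropping the last \<open>k\<close> bits keeps the multiplications short; \<open>+ 1\<close> makes the test safe.\<close>

definition lc_test :: "nat \<Rightarrow> int \<Rightarrow> int \<Rightarrow> int \<Rightarrow> bool" where
  "lc_test k a b c \<longleftrightarrow> (drop_bit k a + 1) * (drop_bit k c + 1) < drop_bit k b * drop_bit k b"

text \<open>1048576 is \<open>2 ^ 20\<close>: the shift grows by one bit whenever the truncated
  value reaches this size, so the factors in \<open>lc_test\<close> stay near 20 bits. By
  \<open>lc_test_imp\<close> the test is sound for every shift.\<close>

definition next_shift :: "nat \<Rightarrow> int \<Rightarrow> nat" where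
  "next_shift k c = (if drop_bit k c < 1048576 then k else Suc k)"

text \<open>
  The Boolean argument carries the outcome of the previous test, so that it is evaluated before the
  recursive call is unfolded.
\<close>

fun lc_run :: "nat \<Rightarrow> bool \<Rightarrow> nat \<Rightarrow> int \<Rightarrow> int list \<Rightarrow> bool" where
  "lc_run f False k c L = False"
| "lc_run 0 True k c L = True"
| "lc_run (Suc f) True k c (b # a # L) =
     lc_run f (lc_test k a b c) (next_shift k c) (psum 1 (c # b # a # L)) (c # b # a # L)"
| "lc_run (Suc f) True k c L = False"

section \<open>Correctness of the list computation\<close>

definition plist :: "nat \<Rightarrow> int list" where
  "plist n = map (\<lambda>i. int (part (n - i))) [0..<Suc n]"

lemma length_plist: "length (plist n) = Suc n"
  by (simp add: plist_def)

lemma nth_plist: "i \<le> n \<Longrightarrow> plist n ! i = int (part (n - i))"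
  by (simp add: plist_def del: upt_Suc)

lemma plist_Suc: "plist (Suc n) = int (part (Suc n)) # plist n"
  by (rule nth_equalityI) (auto simp: length_plist nth_plist nth_Cons split: nat.splits)

text \<open>The walk that starts at index \<open>s\<close> computes the tail of the recurrence from
  \<open>s\<close> on, with signs normalised to begin with plus; hence the downward induction,
  started at \<open>Suc k\<close>, where both list and sum are empty. The offset \<open>- 1\<close>
  arises because the list begins with p(n), whereas the recurrence is for p(n + 1).\<close>

lemma psum_plist:
  assumes "1 \<le> s" and "s \<le> Suc k" and "Suc n \<le> k"
  shows "psum s (drop (s * (3 * s - 1) div 2 - 1) (plist n)) = (\<Sum>i=s..k. (-1) ^ (i + s) *
     ((if i * (3 * i - 1) div 2 \<le> Suc n then int (part (Suc n - i * (3 * i - 1) div 2)) else 0) +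
      (if i * (3 * i + 1) div 2 \<le> Suc n then int (part (Suc n - i * (3 * i + 1) div 2)) else 0)))"
  (is "psum s (drop _ _) = (\<Sum>i=s..k. (-1) ^ (i + s) * (?a i + ?b i))")
  using assms(2,1)
proof (induction s rule: inc_induct)
  case base
  have "Suc k * 2 \<le> Suc k * (3 * Suc k - 1)"
    by (rule mult_le_mono2) simp
  then have "Suc k \<le> Suc k * (3 * Suc k - 1) div 2"
    by (metis div_le_mono nonzero_mult_div_cancel_right zero_neq_numeral)
  then have "Suc n \<le> Suc k * (3 * Suc k - 1) div 2 - 1"
    using assms by linarith
  then show ?case by (simp add: length_plist)
next
  case (step s)
  define g where "g = s * (3 * s - 1) div 2"
  have g1: "s * (3 * s - 1) = 2 * g"
    unfolding g_def by (cases s) auto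
  have "g \<ge> 1"
  proof -
    have "1 * 2 \<le> s * (3 * s - 1)" using step by (intro mult_le_mono) auto
    then show ?thesis using g1 by linarith
  qed
  have gb: "s * (3 * s + 1) div 2 = g + s"
  proof -
    have "s * (3 * s + 1) = s * (3 * s - 1) + 2 * s" by (cases s) (auto simp: algebra_simps)
    then show ?thesis using g1 by simp
  qed
  have gn: "Suc s * (3 * Suc s - 1) div 2 = g + s + (2 * s + 1)"
  proof -
    have "Suc s * (3 * Suc s - 1) = s * (3 * s - 1) + 2 * (3 * s + 1)"
      by (cases s) (auto simp: algebra_simps)
    then show ?thesis using g1 by simp
  qed
  let ?S = "\<lambda>s. \<Sum>i=s..k. (-1) ^ (i + s) * (?a i + ?b i)"
  have IH: "psum (Suc s) (drop (g + s + 2 * s) (plist n)) = ?S (Suc s)"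
    using step.IH unfolding gn by simp
  have "?S s = (?a s + ?b s) + (\<Sum>i=Suc s..k. (-1) ^ (i + s) * (?a i + ?b i))"
    using step by (subst sum.atLeast_Suc_atMost) auto
  also have "(\<Sum>i=Suc s..k. (-1) ^ (i + s) * (?a i + ?b i)) = - ?S (Suc s)"
    unfolding sum_negf[symmetric] by (rule sum.cong) auto
  finally have S: "?S s = ?a s + ?b s - ?S (Suc s)" by simp
  have a: "?a s = (if g \<le> Suc n then int (part (Suc n - g)) else 0)"
    unfolding g_def ..
  have b: "?b s = (if g + s \<le> Suc n then int (part (Suc n - (g + s))) else 0)"
    unfolding gb ..
  have D: "drop j (plist n) = int (part (n - j)) # drop (Suc j) (plist n)" if "j \<le> n" for j
    using that by (simp add: Cons_nth_drop_Suc[symmetric] length_plist nth_plist)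
  have E: "drop j (plist n) = []" if "Suc n \<le> j" for j
    using that by (simp add: length_plist)
  have psum0: "psum i [] = 0" for i by simp
  show ?case
  proof (cases "g \<le> Suc n")
    case False
    then have "?S (Suc s) = 0"
      unfolding IH[symmetric] by (subst E) auto
    then show ?thesis using False unfolding S unfolding a b g_def[symmetric] by (simp add: E)
  next
    case g_le: True
    then have Dg: "drop (g - 1) (plist n) = int (part (Suc n - g)) # drop g (plist n)"
      using D[of "g - 1"] \<open>g \<ge> 1\<close> by (simp add: Suc_diff_le)
    have c1: "chop s (drop (g - 1) (plist n)) = drop (g + s - 1) (plist n)"
      using \<open>g \<ge> 1\<close> by (simp add: chop_eq_drop add.commute)
    have *: "psum s (drop (g - 1) (plist n)) = int (part (Suc n - g)) + psum' s (drop (g + s - 1) (plist n))"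
      unfolding c1[symmetric] by (subst (1 2) Dg) simp
    show ?thesis
    proof (cases "g + s \<le> Suc n")
      case False
      then have "?S (Suc s) = 0"
        unfolding IH[symmetric] by (subst E) auto
      then show ?thesis using False g_le unfolding S unfolding a b g_def[symmetric] * by (simp add: E)
    next
      case True
      have d: "drop (g + s - 1) (plist n) = int (part (Suc n - (g + s))) # drop (g + s) (plist n)"
        using D[of "g + s - 1"] \<open>g \<ge> 1\<close> True by (simp add: Suc_diff_le)
      have e: "g + s + 2 * s = s + (s + (g + s))" by simp
      have "psum' s (drop (g + s - 1) (plist n)) = int (part (Suc n - (g + s))) - ?S (Suc s)"
        unfolding IH[symmetric] e d by (simp add: chop_eq_drop)
      then show ?thesis using True g_le unfolding S unfolding a b g_def[symmetric] * by simp
    qed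
  qed
qed

lemma psum_1_plist: "psum 1 (plist n) = int (part (Suc n))"
  using psum_plist[of 1 "Suc n" n] pentagonal_recurrence[of "Suc n" "Suc n"] by simp

lemma ptable_plist: "ptable k (plist n) = plist (n + k)"
proof (induction k arbitrary: n)
  case (Suc k)
  show ?case
    using Suc[of "Suc n"] psum_1_plist[of n] by (simp add: plist_Suc)
qed simp

lemma plist_0: "plist 0 = [1]"
proof -
  have "part 0 = 1" using rpart_eq_part[of 0 0] by (simp add: rpart_0)
  then show ?thesis by (simp add: plist_def)
qed

lemma ptable_eq_plist: "ptable n [1] = plist n"
  using ptable_plist[of n 0] by (simp add: plist_0)

lemma lc_test_imp:
  assumes "lc_test k a b c" and "0 \<le> a" "0 \<le> b" "0 \<le> c"
  shows "a * c < b * b"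
proof -
  let ?K = "2 ^ k :: int"
  define A B C where "A = a div ?K" and "B = b div ?K" and "C = c div ?K"
  have K: "?K > 0" by simp
  have "a < (A + 1) * ?K" "c < (C + 1) * ?K"
    unfolding A_def C_def using K
    by (metis add.commute div_mult_mod_eq distrib_right less_add_same_cancel1 mult_1 pos_mod_bound add_strict_left_mono)+
  moreover have "A \<ge> 0" "C \<ge> 0" unfolding A_def C_def using assms K by (auto simp: pos_imp_zdiv_nonneg_iff)
  ultimately have "a * c \<le> ((A + 1) * ?K) * ((C + 1) * ?K)"
    using assms by (intro mult_mono) auto
  also have "\<dots> = (A + 1) * (C + 1) * (?K * ?K)" by (simp add: algebra_simps)
  also have "\<dots> < B * B * (?K * ?K)"
    using assms(1) K by (intro mult_strict_right_mono) (auto simp: lc_test_def drop_bit_eq_div A_def B_def C_def)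
  also have "\<dots> = (B * ?K) * (B * ?K)" by (simp add: algebra_simps)
  also have "\<dots> \<le> b * b"
  proof -
    have "B * ?K \<le> b" unfolding B_def by (metis K div_mult_mod_eq le_add_same_cancel1 pos_mod_sign)
    moreover have "0 \<le> B" unfolding B_def using assms K by (auto simp: pos_imp_zdiv_nonneg_iff)
    ultimately show ?thesis using assms by (intro mult_mono) auto
  qed
  finally show ?thesis .
qed

lemma lc_run_imp_flag: "lc_run f b k c L \<Longrightarrow> b"
  by (cases b) auto

text \<open>The state consists of p(n + 2) and the list from p(n + 1) downwards. One pass tests
  position n + 1 and hands the outcome to the next call as its flag, which must be true for the run
  to succeed.\<close>

lemma lc_run_imp:
  assumes "lc_run f b k (int (part (n + 2))) (plist (n + 1))" and "i < f"
  shows "part (n + i) * part (n + i + 2) < part (n + i + 1) ^ 2"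
  using assms
proof (induction f arbitrary: b k n i)
  case (Suc f)
  have b: "b" using Suc.prems(1) by (cases b) auto
  have L: "plist (n + 1) = int (part (n + 1)) # int (part n) # tl (plist n)"
    by (cases n) (simp_all add: plist_Suc plist_0 rpart_eq_part[symmetric] rpart_at_0)
  have r: "lc_run f (lc_test k (int (part n)) (int (part (n + 1))) (int (part (n + 2))))
     (next_shift k (int (part (n + 2))))
     (psum 1 (int (part (n + 2)) # plist (n + 1))) (int (part (n + 2)) # plist (n + 1))"
    using Suc.prems(1) b unfolding L by simp
  show ?case
  proof (cases i)
    case 0
    have t: "lc_test k (int (part n)) (int (part (n + 1))) (int (part (n + 2)))"
      using lc_run_imp_flag[OF r] .
    have "int (part n) * int (part (n + 2)) < int (part (n + 1)) * int (part (n + 1))"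
      by (rule lc_test_imp[OF t]) auto
    then show ?thesis using 0 by (simp add: power2_eq_square flip: of_nat_mult)
  next
    case (Suc j)
    have "int (part (n + 2)) # plist (n + 1) = plist (Suc n + 1)"
      by (simp add: plist_Suc)
    with r have "lc_run f (lc_test k (int (part n)) (int (part (n + 1))) (int (part (n + 2))))
        (next_shift k (int (part (n + 2)))) (int (part (Suc n + 2))) (plist (Suc n + 1))"
      by (simp only: psum_1_plist) simp
    from Suc.IH[OF this, of j] show ?thesis
      using Suc.prems(2) Suc by simp
  qed
qed simp

text \<open>For \<open>L = plist 52\<close> the entry \<open>L ! (52 - k)\<close> is p(k). The
  clauses are the theorem for \<open>n \<le> 25\<close>, where neighbouring log-concavity may fail
  (for example at 25), the comparison of the ratio at 26 with all earlier ones, and exact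
  log-concavity from 26 to 30. The last is needed because the rounded \<open>lc_test\<close> fails
  at 27 even with shift 0.\<close>

definition small_test :: "int list \<Rightarrow> bool" where
  "small_test L \<longleftrightarrow>
     (\<forall>n\<in>set [3..<26]. \<forall>m\<in>set [2..<n]. L ! (52 - (n - m)) * L ! (52 - (n + m)) < L ! (52 - n) * L ! (52 - n)) \<and>
     (\<forall>k\<in>set [1..<26]. L ! (52 - 27) * L ! (52 - k) < L ! (52 - (k + 1)) * L ! (52 - 26)) \<and>
     (\<forall>n\<in>set [26..<31]. L ! (52 - (n - 1)) * L ! (52 - (n + 1)) < L ! (52 - n) * L ! (52 - n))"

lemma small_test_plist: "small_test (plist 52)"
proof -
  have "small_test (ptable 52 [1])" by code_simp
  then show ?thesis by (simp only: ptable_eq_plist)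
qed

lemma part_small_strong:
  assumes "n \<le> 25" "1 < m" "m < n"
  shows "part (n - m) * part (n + m) < part n ^ 2"
proof -
  have "n \<in> set [3..<26]" "m \<in> set [2..<n]"
    unfolding set_upt atLeastLessThan_iff using assms by linarith+
  then have "plist 52 ! (52 - (n - m)) * plist 52 ! (52 - (n + m)) < plist 52 ! (52 - n) * plist 52 ! (52 - n)"
    using small_test_plist unfolding small_test_def by blast
  then show ?thesis
    using assms by (simp add: nth_plist power2_eq_square flip: of_nat_mult)
qed

lemma part_small_ratio:
  assumes "1 \<le> k" "k \<le> 25"
  shows "part 27 * part k < part (k + 1) * part 26"
proof -
  have "k \<in> set [1..<26]" unfolding set_upt atLeastLessThan_iff using assms by linarith
  then have "plist 52 ! (52 - 27) * plist 52 ! (52 - k) < plist 52 ! (52 - (k + 1)) * plist 52 ! (52 - 26)"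
    using small_test_plist unfolding small_test_def by blast
  then show ?thesis
    using assms by (simp add: nth_plist flip: of_nat_mult)
qed

lemma part_log_concave_26_30:
  assumes "26 \<le> n" "n \<le> 30"
  shows "part (n - 1) * part (n + 1) < part n ^ 2"
proof -
  have "n \<in> set [26..<31]" unfolding set_upt atLeastLessThan_iff using assms by linarith
  then have "plist 52 ! (52 - (n - 1)) * plist 52 ! (52 - (n + 1)) < plist 52 ! (52 - n) * plist 52 ! (52 - n)"
    using small_test_plist unfolding small_test_def by blast
  then show ?thesis
    using assms by (simp add: nth_plist power2_eq_square flip: of_nat_mult)
qed

text \<open>The list starts at p(31), so 1450 passes test the positions 31 to 1480.\<close>

lemma lc_run_true: "lc_run 1450 True 0 (psum 1 (ptable 31 [1])) (ptable 31 [1])"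
  by code_simp

lemma part_log_concave_small:
  assumes "26 \<le> n" "n \<le> 1480"
  shows "part (n - 1) * part (n + 1) < part n ^ 2"
proof (cases "n \<le> 30")
  case True
  then show ?thesis using assms part_log_concave_26_30 by blast
next
  case False
  have "lc_run 1450 True 0 (int (part (30 + 2))) (plist (30 + 1))"
    using lc_run_true psum_1_plist[of 31] unfolding ptable_eq_plist by simp
  moreover obtain i where i: "n = 31 + i"
    using False by (metis Suc_leI le_Suc_ex not_le eval_nat_numeral(3))
  ultimately show ?thesis
    using lc_run_imp[of 1450 True 0 30 i] assms by (simp add: add.commute)
qed

section \<open>From log-concavity at neighbours to distance m\<close>

lemma part_pos: "0 < part n"
proof -
  have "replicate_mset n 1 \<in> partitions n"
    by (auto simp: partitions_def)
  moreover have "finite (partitions n)"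
    using finite_restricted_partitions[of n n] by (simp add: restricted_partitions_eq_partitions)
  ultimately show ?thesis by (auto simp: part_def card_gt_0_iff)
qed

lemma part_strong_log_concave:
  assumes lc: "\<And>n. 26 \<le> n \<Longrightarrow> part (n - 1) * part (n + 1) < part n ^ 2"
    and "1 < m" "m < n"
  shows "part (n - m) * part (n + m) < part n ^ 2"
proof (cases "n \<le> 25")
  case True
  then show ?thesis using part_small_strong assms by blast
next
  case False
  define \<rho> where "\<rho> k = real (part (Suc k)) / real (part k)" for k
  have \<rho>_pos: "\<rho> k > 0" for k by (simp add: \<rho>_def part_pos)
  have step: "\<rho> (Suc k) < \<rho> k" if "25 \<le> k" for k
  proof -
    have "part k * part (Suc (Suc k)) < part (Suc k) * part (Suc k)"
      using lc[of "Suc k"] that by (simp add: power2_eq_square)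
    then have "real (part k) * real (part (Suc (Suc k))) < real (part (Suc k)) * real (part (Suc k))"
      by (simp flip: of_nat_mult)
    then show ?thesis by (simp add: \<rho>_def part_pos field_simps)
  qed
  have mono: "\<rho> l \<le> \<rho> k" if "25 \<le> k" "k \<le> l" for k l
    using that(2)
  proof (induction l rule: dec_induct)
    case (step i)
    then show ?case using \<open>\<And>k. 25 \<le> k \<Longrightarrow> \<rho> (Suc k) < \<rho> k\<close>[of i] that by linarith
  qed simp
  \<comment> \<open>The ratios are not monotone below 25, but all of them from \<open>k = 1\<close>
    on exceed \<open>\<rho> 26\<close>. The index 0 has to be excluded, as
    \<open>\<rho> 0 = 1\<close>; this is where \<open>m < n\<close> enters.\<close>
  have less: "\<rho> l < \<rho> k" if "1 \<le> k" "k < l" "26 \<le> l" for k l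
  proof (cases "k \<le> 25")
    case True
    have "real (part 27) * real (part k) < real (part (k + 1)) * real (part 26)"
      using part_small_ratio[of k] True that by (simp flip: of_nat_mult)
    then have "\<rho> 26 < \<rho> k" by (simp add: \<rho>_def part_pos field_simps)
    then show ?thesis using mono[of 26 l] that by simp
  next
    case False
    then show ?thesis using step[of k] mono[of "Suc k" l] that by simp
  qed
  have prod: "real (part (a + j)) = real (part a) * (\<Prod>i<j. \<rho> (a + i))" for a j
    using part_pos by (induction j) (auto simp: \<rho>_def)
  let ?P = "\<Prod>i<m. \<rho> (n + i)" and ?Q = "\<Prod>i<m. \<rho> (n - m + i)"
  have "?P < ?Q"
    using assms False by (intro prod_mono_strict) (auto intro!: less less_imp_le[OF less] \<rho>_pos less_imp_le[OF \<rho>_pos])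
  have "real (part (n - m)) * real (part (n + m)) = real (part (n - m)) * real (part n) * ?P"
    using prod[of n m] by simp
  also have "\<dots> < real (part (n - m)) * real (part n) * ?Q"
    using \<open>?P < ?Q\<close> part_pos by (intro mult_strict_left_mono) auto
  also have "\<dots> = real (part n) * real (part n)"
    using prod[of "n - m" m] assms by simp
  finally show ?thesis
    by (simp add: power2_eq_square flip: of_nat_mult)
qed

section \<open>Moments of the saddle point distribution\<close>

lemma sum_le_sums:
  fixes f :: "nat \<Rightarrow> real"
  assumes "f sums s" "finite I" "\<And>n. n \<notin> I \<Longrightarrow> 0 \<le> f n"
  shows "sum f I \<le> s"
  using sum_le_suminf[of f I] assms by (auto simp: sums_iff)

text \<open>Differentiating the power series termwise and multiplying by \<open>x\<close> raises the
  exponent \<open>p\<close> by one without changing the disc of convergence.\<close>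

lemma summable_power_times_power:
  fixes x :: real
  assumes "0 \<le> x" "x < 1"
  shows "summable (\<lambda>n. real n ^ p * x ^ n)"
  using assms
proof (induction p arbitrary: x)
  case 0
  then show ?case by (simp add: summable_geometric)
next
  case (Suc p)
  have s: "summable (\<lambda>n. real n ^ p * y ^ n)" if "norm y < 1" for y :: real
  proof (rule summable_norm_cancel)
    show "summable (\<lambda>n. norm (real n ^ p * y ^ n))"
      using Suc.IH[of "\<bar>y\<bar>"] that by (simp add: abs_mult power_abs)
  qed
  have "summable (\<lambda>n. diffs (\<lambda>n. real n ^ p) n * x ^ n)"
    by (rule termdiff_converges[where K = 1]) (use s Suc.prems in auto)
  then have "summable (\<lambda>n. x * (diffs (\<lambda>n. real n ^ p) n * x ^ n))"
    by (rule summable_mult)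
  then have "summable (\<lambda>n. real (Suc n) ^ Suc p * x ^ Suc n)"
    by (simp add: diffs_def algebra_simps)
  then show ?case
    by (subst (asm) summable_Suc_iff)
qed

lemma geometric_moment_1:
  fixes x :: real
  assumes "0 \<le> x" "x < 1"
  shows "(\<lambda>n. real n * x ^ n) sums (x / (1 - x)\<^sup>2)"
proof -
  have "(\<lambda>n. x * (real (Suc n) * x ^ n)) sums (x * (1 / (1 - x)\<^sup>2))"
    by (intro sums_mult geometric_deriv_sums) (use assms in auto)
  then have "(\<lambda>n. real (Suc n) * x ^ Suc n) sums (x / (1 - x)\<^sup>2)"
    by (simp add: algebra_simps)
  then show ?thesis by (subst (asm) sums_Suc_iff) simp
qed

lemma geometric_moment_0:
  fixes x :: real
  assumes "0 \<le> x" "x < 1"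
  shows "(\<lambda>n. (if n = 0 then 0 else 1) * x ^ n) sums (x / (1 - x))"
proof -
  have "(\<lambda>n. x * x ^ n) sums (x * (1 / (1 - x)))"
    by (intro sums_mult geometric_sums) (use assms in auto)
  then have "(\<lambda>n. (if Suc n = 0 then 0 else 1) * x ^ Suc n) sums (x / (1 - x))"
    by simp
  then show ?thesis by (subst (asm) sums_Suc_iff) simp
qed

text \<open>Shifting the index and expanding \<open>(n + 1) ^ 2\<close> expresses the sum by itself
  and the lower moments; this is a linear equation for \<open>T\<close>. The third moment is found
  in the same way.\<close>

lemma geometric_moment_2:
  fixes x :: real
  assumes "0 \<le> x" "x < 1"
  shows "(\<lambda>n. real n ^ 2 * x ^ n) sums (x * (1 + x) / (1 - x) ^ 3)"
proof -
  define T where "T = (\<Sum>n. real n ^ 2 * x ^ n)"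
  have T: "(\<lambda>n. real n ^ 2 * x ^ n) sums T"
    unfolding T_def using summable_power_times_power[OF assms] by (rule summable_sums)
  have "(\<lambda>n. real n ^ 2 * x ^ n + 2 * (real n * x ^ n) + x ^ n) sums (T + 2 * (x / (1 - x)\<^sup>2) + 1 / (1 - x))"
    by (intro sums_add sums_mult T geometric_moment_1 geometric_sums) (use assms in auto)
  then have A: "(\<lambda>n. x * (real n ^ 2 * x ^ n + 2 * (real n * x ^ n) + x ^ n)) sums
      (x * (T + 2 * (x / (1 - x)\<^sup>2) + 1 / (1 - x)))"
    by (rule sums_mult)
  have eq: "(\<lambda>n. x * (real n ^ 2 * x ^ n + 2 * (real n * x ^ n) + x ^ n)) = (\<lambda>n. real (Suc n) ^ 2 * x ^ Suc n)"
    by (auto simp: algebra_simps power2_eq_square)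
  have B: "(\<lambda>n. real (Suc n) ^ 2 * x ^ Suc n) sums T"
    using T by (subst sums_Suc_iff) simp
  have "T = x * (T + 2 * (x / (1 - x)\<^sup>2) + 1 / (1 - x))"
    using B A[unfolded eq] by (rule sums_unique2)
  then have "T * (1 - x) = x * (2 * (x / (1 - x)\<^sup>2) + 1 / (1 - x))"
    by (simp add: algebra_simps)
  also have "\<dots> = x * (1 + x) / (1 - x) ^ 2"
    using assms by (simp add: divide_simps power2_eq_square)
  finally have "T = x * (1 + x) / (1 - x) ^ 3"
    using assms by (simp add: eq_divide_eq power_numeral_reduce mult_ac)
  with T show ?thesis by simp
qed

lemma geometric_moment_3:
  fixes x :: real
  assumes "0 \<le> x" "x < 1"
  shows "(\<lambda>n. real n ^ 3 * x ^ n) sums (x * (1 + 4 * x + x\<^sup>2) / (1 - x) ^ 4)"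
proof -
  define T where "T = (\<Sum>n. real n ^ 3 * x ^ n)"
  define w where "w = 1 - x"
  have w: "w \<noteq> 0" "x = 1 - w" using assms by (auto simp: w_def)
  have T: "(\<lambda>n. real n ^ 3 * x ^ n) sums T"
    unfolding T_def using summable_power_times_power[OF assms] by (rule summable_sums)
  let ?S = "T + 3 * (x * (1 + x) / (1 - x) ^ 3) + 3 * (x / (1 - x)\<^sup>2) + 1 / (1 - x)"
  have "(\<lambda>n. real n ^ 3 * x ^ n + 3 * (real n ^ 2 * x ^ n) + 3 * (real n * x ^ n) + x ^ n) sums ?S"
    by (intro sums_add sums_mult T geometric_moment_1 geometric_moment_2 geometric_sums) (use assms in auto)
  then have A: "(\<lambda>n. x * (real n ^ 3 * x ^ n + 3 * (real n ^ 2 * x ^ n) + 3 * (real n * x ^ n) + x ^ n)) sums (x * ?S)"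
    by (rule sums_mult)
  have eq: "(\<lambda>n. x * (real n ^ 3 * x ^ n + 3 * (real n ^ 2 * x ^ n) + 3 * (real n * x ^ n) + x ^ n)) =
      (\<lambda>n. real (Suc n) ^ 3 * x ^ Suc n)"
    by (auto simp: algebra_simps power2_eq_square power3_eq_cube)
  have B: "(\<lambda>n. real (Suc n) ^ 3 * x ^ Suc n) sums T"
    using T by (subst sums_Suc_iff) simp
  have "T = x * ?S"
    using B A[unfolded eq] by (rule sums_unique2)
  then have "T * w = (1 - w) * (3 * ((1 - w) * (2 - w) / w ^ 3) + 3 * ((1 - w) / w\<^sup>2) + 1 / w)"
    unfolding w(2) by (simp add: algebra_simps)
  also have "\<dots> = (1 - w) * (1 + 4 * (1 - w) + (1 - w)\<^sup>2) / w ^ 3"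
    using w(1) by (simp add: divide_simps) algebra
  finally have "T = (1 - w) * (1 + 4 * (1 - w) + (1 - w)\<^sup>2) / w ^ 4"
    using w(1) by (simp add: field_simps power_numeral_reduce)
  with T show ?thesis by (simp add: w_def)
qed

lemma two_cosh_lower:
  fixes y :: real
  shows "y\<^sup>2 + y ^ 4 / 12 + y ^ 6 / 360 \<le> 2 * cosh y - 2"
proof -
  have "(\<lambda>n. if even n then y ^ n /\<^sub>R fact n else 0) sums cosh y"
    by (rule cosh_converges)
  then have "(\<Sum>n\<in>{0,2,4,6}. if even n then y ^ n /\<^sub>R fact n else 0) \<le> cosh y"
    by (rule sum_le_sums) (auto simp: zero_le_even_power)
  then show ?thesis
    by (simp add: fact_numeral divide_simps)
qed

lemma exp_quotient_cosh:
  fixes y :: real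
  assumes "0 < y"
  shows "(1 - exp (-y))\<^sup>2 / exp (-y) = 2 * cosh y - 2"
  by (simp add: cosh_def power2_eq_square field_simps exp_minus)

text \<open>Everything depends on \<open>h = (1 - x)\<^sup>2 / x = 2 * cosh y - 2\<close>: the first
  and third quantities are \<open>1 / h\<close> and \<open>(h + 6) / h\<^sup>2\<close>, and the
  square of the second is \<open>(h + 4) / h ^ 3\<close>. A Taylor lower bound for \<open>h\<close>
  therefore suffices. In the third bound the limiting constant 6 would be too small for small
  \<open>y\<close>; 33/5 is \<open>6 * 11/10\<close>.\<close>

lemma exp_moment_bounds:
  fixes y :: real
  assumes y: "0 < y"
  defines "x \<equiv> exp (-y)"
  shows "x / (1 - x)\<^sup>2 \<le> 1 / y\<^sup>2"
    and "x * (1 + x) / (1 - x) ^ 3 \<le> 2 / y ^ 3"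
    and "x * (1 + 4 * x + x\<^sup>2) / (1 - x) ^ 4 \<le> (33/5) / y ^ 4"
proof -
  define h where "h = (1 - x)\<^sup>2 / x"
  define v where "v = y\<^sup>2 / 12"
  define w where "w = h / y\<^sup>2"
  have x: "0 < x" "x < 1" using y by (auto simp: x_def)
  have v: "v > 0" using y by (simp add: v_def)
  have "h \<ge> y\<^sup>2 + y ^ 4 / 12 + y ^ 6 / 360"
    unfolding h_def x_def exp_quotient_cosh[OF y] by (rule two_cosh_lower)
  also have "y\<^sup>2 + y ^ 4 / 12 + y ^ 6 / 360 = y\<^sup>2 * (1 + v + 2/5 * v\<^sup>2)"
    by (simp add: v_def power2_eq_square algebra_simps power_numeral_reduce)
  finally have w: "w \<ge> 1 + v + 2/5 * v\<^sup>2"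
    using y by (simp add: w_def field_simps)
  then have w1: "w \<ge> 1 + v" using zero_le_power2[of v] by linarith
  have h: "h > 0" using x by (simp add: h_def)
  have hw: "h = y\<^sup>2 * w" using y by (simp add: w_def)
  have e1: "x / (1 - x)\<^sup>2 = 1 / h" by (simp add: h_def)
  show "x / (1 - x)\<^sup>2 \<le> 1 / y\<^sup>2"
    unfolding e1 hw using y w1 v by (simp add: field_simps)
  have e3: "x * (1 + 4 * x + x\<^sup>2) / (1 - x) ^ 4 = (h + 6) / h\<^sup>2"
  proof -
    have "(h + 6) / h\<^sup>2 = (1 / h) * (1 + 6 * (1 / h))" using h by (simp add: field_simps power2_eq_square)
    also have "\<dots> = x / (1 - x)\<^sup>2 * (1 + 6 * (x / (1 - x)\<^sup>2))" by (simp only: e1)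
    also have "\<dots> = x * ((1 - x)\<^sup>2 + 6 * x) / ((1 - x)\<^sup>2 * (1 - x)\<^sup>2)"
      using x by (simp add: field_simps)
    also have "\<dots> = x * (1 + 4 * x + x\<^sup>2) / (1 - x) ^ 4"
      by (simp add: power2_eq_square power4_eq_xxxx algebra_simps)
    finally show ?thesis ..
  qed
  have "2 * v * w + 1 \<le> 11/10 * w\<^sup>2"
  proof -
    have "2 * v \<le> 11/10 * w + 11/10 * (1 + v + 2/5 * v\<^sup>2)"
    proof -
      have "11/10 * (1 + v) \<le> 11/10 * (1 + v + 2/5 * v\<^sup>2)" by simp
      moreover have "2 * v \<le> 11/10 * w + 11/10 * (1 + v)" using w1 v by (simp add: field_simps)
      ultimately show ?thesis by linarith
    qed
    \<comment> \<open>The product expresses that \<open>11/10 * w\<^sup>2 - 2 * v * w\<close> is at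
      least its value at the lower bound for \<open>w\<close>, which reduces the claim to a
      polynomial in \<open>v\<close>.\<close>
    then have "0 \<le> (w - (1 + v + 2/5 * v\<^sup>2)) * (11/10 * w + 11/10 * (1 + v + 2/5 * v\<^sup>2) - 2 * v)"
      using w by (intro mult_nonneg_nonneg) auto
    also have "\<dots> = (11/10 * w\<^sup>2 - 2 * v * w) - (11/10 * (1 + v + 2/5 * v\<^sup>2)\<^sup>2 - 2 * v * (1 + v + 2/5 * v\<^sup>2))"
      by (simp add: field_simps power2_eq_square)
    also have "11/10 * (1 + v + 2/5 * v\<^sup>2)\<^sup>2 - 2 * v * (1 + v + 2/5 * v\<^sup>2) =
        1 + 1/10 + v/5 - v\<^sup>2/50 + 2/25 * v^3 + 22/125 * v^4"
      by (simp add: algebra_simps power2_eq_square power3_eq_cube power4_eq_xxxx)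
    finally have "11/10 * w\<^sup>2 - 2 * v * w \<ge> 1 + 1/10 + v/5 - v\<^sup>2/50 + 2/25 * v^3 + 22/125 * v^4" by simp
    moreover have "v/5 - v\<^sup>2/50 + 2/25 * v^3 \<ge> 0"
    proof -
      have "v/5 - v\<^sup>2/50 + 2/25 * v^3 = v * (1/5 - v/50 + 2/25 * v\<^sup>2)"
        by (simp add: algebra_simps power2_eq_square power3_eq_cube)
      moreover have "1/5 - v/50 + 2/25 * v\<^sup>2 = 2/25 * (v - 1/8)\<^sup>2 + (1/5 - 1/800)"
        by (simp add: algebra_simps power2_eq_square)
      ultimately show ?thesis using v by simp
    qed
    moreover have "0 \<le> v ^ 4" by simp
    ultimately show ?thesis by linarith
  qed
  then have "y\<^sup>2 * w + 6 \<le> (33/5) * w\<^sup>2"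
    unfolding v_def by (simp add: algebra_simps)
  then have "(h + 6) / h\<^sup>2 \<le> ((33/5) * w\<^sup>2) / h\<^sup>2"
    unfolding hw by (rule divide_right_mono) simp
  also have "\<dots> = (33/5) / y ^ 4"
    unfolding hw using y w1 v by (simp add: power_mult_distrib flip: power_mult)
  finally show "x * (1 + 4 * x + x\<^sup>2) / (1 - x) ^ 4 \<le> (33/5) / y ^ 4"
    unfolding e3 .
  have e2: "(x * (1 + x) / (1 - x) ^ 3)\<^sup>2 = (h + 4) / h ^ 3"
  proof -
    have "(h + 4) / h ^ 3 = (1 / h)\<^sup>2 * (1 + 4 * (1 / h))"
      using h by (simp add: field_simps power2_eq_square power3_eq_cube)
    also have "\<dots> = (x / (1 - x)\<^sup>2)\<^sup>2 * (1 + 4 * (x / (1 - x)\<^sup>2))" by (simp only: e1)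
    also have "1 + 4 * (x / (1 - x)\<^sup>2) = ((1 - x)\<^sup>2 + 4 * x) / (1 - x)\<^sup>2"
      using x by (simp add: add_divide_distrib)
    also have "(1 - x)\<^sup>2 + 4 * x = (1 + x)\<^sup>2"
      by (simp add: power2_eq_square algebra_simps)
    also have "(1 + x)\<^sup>2 / (1 - x)\<^sup>2 = ((1 + x) / (1 - x))\<^sup>2"
      by (simp add: power_divide)
    also have "(x / (1 - x)\<^sup>2)\<^sup>2 * ((1 + x) / (1 - x))\<^sup>2 = (x * (1 + x) / (1 - x) ^ 3)\<^sup>2"
      by (simp add: power2_eq_square power3_eq_cube mult_ac)
    finally show ?thesis ..
  qed
  have "3 * v * w + 1 \<le> w ^ 3"
  proof -
    \<comment> \<open>The same device for \<open>w ^ 3 - 3 * v * w\<close>, with the weaker lower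
      bound \<open>1 + v\<close>.\<close>
    have "0 \<le> (w - (1 + v)) * (w\<^sup>2 + w * (1 + v) + (1 + v)\<^sup>2 - 3 * v)"
    proof (intro mult_nonneg_nonneg)
      have "0 \<le> w\<^sup>2" "0 \<le> w * (1 + v)" using w1 v by auto
      moreover have "(1 + v)\<^sup>2 - 3 * v = (v - 1/2)\<^sup>2 + 3/4" by (simp add: power2_eq_square algebra_simps)
      ultimately show "0 \<le> w\<^sup>2 + w * (1 + v) + (1 + v)\<^sup>2 - 3 * v"
        using zero_le_power2[of "v - 1/2"] by linarith
    qed (use w1 in simp)
    also have "\<dots> = w ^ 3 - 3 * v * w - 1 - v ^ 3"
      by (simp add: algebra_simps power2_eq_square power3_eq_cube)
    finally show ?thesis using zero_less_power[OF v, of 3] by linarith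
  qed
  then have "y\<^sup>2 * w + 4 \<le> 4 * w ^ 3"
    unfolding v_def by (simp add: algebra_simps)
  then have "(h + 4) / h ^ 3 \<le> (4 * w ^ 3) / h ^ 3"
    unfolding hw using w1 v by (intro divide_right_mono) auto
  also have "\<dots> = (2 / y ^ 3)\<^sup>2"
    unfolding hw using y w1 v by (simp add: power_mult_distrib power_divide flip: power_mult)
  finally have "(h + 4) / h ^ 3 \<le> (2 / y ^ 3)\<^sup>2" .
  then show "x * (1 + x) / (1 - x) ^ 3 \<le> 2 / y ^ 3"
    unfolding e2[symmetric] by (rule power2_le_imp_le) (use y in simp)
qed

text \<open>Expand \<open>F\<close> and exchange the sums: the coefficient of \<open>c k\<close> is
  a partial sum of \<open>G (r ^ k)\<close>. By \<open>B\<close> the k-th term is at most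
  \<open>B / k\<^sup>2\<close>, and these add up to \<open>B * (pi\<^sup>2 / 6)\<close> whatever
  \<open>M\<close> is.\<close>

lemma double_sum_bound:
  fixes c d :: "nat \<Rightarrow> real"
  assumes F: "\<And>x. 0 \<le> x \<Longrightarrow> x < 1 \<Longrightarrow> (\<lambda>k. c k * x ^ k) sums F x"
    and G: "\<And>x. 0 \<le> x \<Longrightarrow> x < 1 \<Longrightarrow> (\<lambda>k. d k * x ^ k) sums G x"
    and c: "\<And>k. 0 \<le> c k" "c 0 = 0" and d: "\<And>k. 0 \<le> d k"
    and r: "0 < r" "r < 1"
    and B: "\<And>k. 1 \<le> k \<Longrightarrow> c k * G (r ^ k) \<le> B / real k ^ 2"
  shows "(\<Sum>j=1..M. d j * F (r ^ j)) \<le> B * (pi\<^sup>2 / 6)"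
proof (rule sums_le)
  have rk: "0 \<le> r ^ k" "1 \<le> k \<Longrightarrow> r ^ k < 1" for k
    using r by (auto simp: power_less_one_iff)
  show "(\<lambda>k. \<Sum>j=1..M. d j * (c k * (r ^ j) ^ k)) sums (\<Sum>j=1..M. d j * F (r ^ j))"
    by (intro sums_sum sums_mult F) (use rk in auto)
  have "(\<lambda>k. B * (1 / real (Suc k) ^ 2)) sums (B * (pi\<^sup>2 / 6))"
    using inverse_squares_sums by (intro sums_mult) (simp add: add.commute)
  then have "(\<lambda>k. B / real (Suc k) ^ 2) sums (B * (pi\<^sup>2 / 6))"
    by simp
  then show "(\<lambda>k. B / real k ^ 2) sums (B * (pi\<^sup>2 / 6))"
    by (subst (asm) sums_Suc_iff) simp
  show "(\<Sum>j=1..M. d j * (c k * (r ^ j) ^ k)) \<le> B / real k ^ 2" for k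
  proof (cases "k = 0")
    case True
    then show ?thesis using c by simp
  next
    case False
    have "(\<Sum>j=1..M. d j * (c k * (r ^ j) ^ k)) = c k * (\<Sum>j=1..M. d j * (r ^ k) ^ j)"
      by (simp add: sum_distrib_left mult_ac flip: power_mult)
    also have "(\<Sum>j=1..M. d j * (r ^ k) ^ j) \<le> G (r ^ k)"
      using False by (intro sum_le_sums[OF G]) (use rk d in auto)
    then have "c k * (\<Sum>j=1..M. d j * (r ^ k) ^ j) \<le> c k * G (r ^ k)"
      using c(1) by (rule mult_left_mono)
    also have "\<dots> \<le> B / real k ^ 2" using False by (intro B) auto
    finally show ?thesis .
  qed
qed

context
  fixes t r :: real and M :: nat
  assumes t: "0 < t" and r_def: "r = exp (-t)"
begin

lemma r_bounds: "0 < r" "r < 1" and r_power: "r ^ k = exp (- (real k * t))"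
  using t by (auto simp: r_def exp_of_nat_mult[symmetric])

text \<open>This sum and the next two are the mean, variance and third cumulant of the size of a
  random partition into parts at most \<open>M\<close>, where a partition of \<open>k\<close> has
  weight \<open>r ^ k\<close>.\<close>

lemma mean_bound: "(\<Sum>j=1..M. real j * (r ^ j / (1 - r ^ j))) \<le> (1 / t\<^sup>2) * (pi\<^sup>2 / 6)"
proof (rule double_sum_bound[OF geometric_moment_0 geometric_moment_1 _ _ _ r_bounds])
  fix k :: nat assume k: "1 \<le> k"
  have "r ^ k / (1 - r ^ k)\<^sup>2 \<le> 1 / (real k * t)\<^sup>2"
    unfolding r_power by (rule exp_moment_bounds) (use k t in auto)
  then show "(if k = 0 then 0 else 1) * (r ^ k / (1 - r ^ k)\<^sup>2) \<le> (1 / t\<^sup>2) / (real k)\<^sup>2"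
    using k by (simp add: power_mult_distrib mult.commute)
qed auto

lemma variance_bound: "(\<Sum>j=1..M. real j ^ 2 * (r ^ j / (1 - r ^ j)\<^sup>2)) \<le> (2 / t ^ 3) * (pi\<^sup>2 / 6)"
proof (rule double_sum_bound[OF geometric_moment_1 geometric_moment_2 _ _ _ r_bounds])
  fix k :: nat assume k: "1 \<le> k"
  have "r ^ k * (1 + r ^ k) / (1 - r ^ k) ^ 3 \<le> 2 / (real k * t) ^ 3"
    unfolding r_power by (rule exp_moment_bounds) (use k t in auto)
  then have "real k * (r ^ k * (1 + r ^ k) / (1 - r ^ k) ^ 3) \<le> real k * (2 / (real k * t) ^ 3)"
    by (rule mult_left_mono) simp
  also have "\<dots> = (2 / t ^ 3) / (real k)\<^sup>2"
    using k t by (simp add: field_simps power2_eq_square power3_eq_cube)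
  finally show "real k * (r ^ k * (1 + r ^ k) / (1 - r ^ k) ^ 3) \<le> (2 / t ^ 3) / (real k)\<^sup>2" .
qed auto

lemma third_moment_bound:
  "(\<Sum>j=1..M. real j ^ 3 * (r ^ j * (1 + r ^ j) / (1 - r ^ j) ^ 3)) \<le> ((33/5) / t ^ 4) * (pi\<^sup>2 / 6)"
proof (rule double_sum_bound[OF geometric_moment_2 geometric_moment_3 _ _ _ r_bounds])
  fix k :: nat assume k: "1 \<le> k"
  have "r ^ k * (1 + 4 * r ^ k + (r ^ k)\<^sup>2) / (1 - r ^ k) ^ 4 \<le> (33/5) / (real k * t) ^ 4"
    unfolding r_power by (rule exp_moment_bounds) (use k t in auto)
  then have "(real k)\<^sup>2 * (r ^ k * (1 + 4 * r ^ k + (r ^ k)\<^sup>2) / (1 - r ^ k) ^ 4) \<le> (real k)\<^sup>2 * ((33/5) / (real k * t) ^ 4)"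
    by (rule mult_left_mono) simp
  also have "\<dots> = ((33/5) / t ^ 4) / (real k)\<^sup>2"
    using k t by (simp add: field_simps power2_eq_square power4_eq_xxxx)
  finally show "(real k)\<^sup>2 * (r ^ k * (1 + 4 * r ^ k + (r ^ k)\<^sup>2) / (1 - r ^ k) ^ 4) \<le> ((33/5) / t ^ 4) / (real k)\<^sup>2" .
qed auto

end

section \<open>The factors of the generating function on a circle\<close>

lemma one_minus_cos_le: "1 - cos y \<le> y\<^sup>2 / 2" for y :: real
proof -
  have "1 - cos y = 2 * (sin (y / 2))\<^sup>2"
    using cos_double_sin[of "y / 2"] by simp
  also have "(sin (y / 2))\<^sup>2 \<le> (y / 2)\<^sup>2"
    using abs_sin_x_le_abs_x[of "y / 2"] by (metis abs_le_square_iff)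
  finally show ?thesis by (simp add: power2_eq_square)
qed

lemma sin_ge_cubic: "y - y ^ 3 / 6 \<le> sin y" if "0 \<le> y" for y :: real
proof -
  let ?f = "\<lambda>y :: real. sin y - y + y ^ 3 / 6"
  have "?f 0 \<le> ?f y"
  proof (rule DERIV_nonneg_imp_nondecreasing[OF that])
    fix x :: real assume "0 \<le> x" "x \<le> y"
    have "(?f has_real_derivative (cos x - 1 + x\<^sup>2 / 2)) (at x)"
      by (auto intro!: derivative_eq_intros simp: power2_eq_square)
    moreover have "0 \<le> cos x - 1 + x\<^sup>2 / 2"
      using one_minus_cos_le[of x] by simp
    ultimately show "\<exists>d. (?f has_real_derivative d) (at x) \<and> 0 \<le> d" by blast
  qed
  then show ?thesis by simp
qed

lemma cos_le_quartic: "cos y \<le> 1 - y\<^sup>2 / 2 + y ^ 4 / 24" if "0 \<le> y" for y :: real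
proof -
  let ?f = "\<lambda>y :: real. 1 - y\<^sup>2 / 2 + y ^ 4 / 24 - cos y"
  have "?f 0 \<le> ?f y"
  proof (rule DERIV_nonneg_imp_nondecreasing[OF that])
    fix x :: real assume x: "0 \<le> x" "x \<le> y"
    have "(?f has_real_derivative (sin x - x + x ^ 3 / 6)) (at x)"
      by (auto intro!: derivative_eq_intros simp: power2_eq_square)
    moreover have "0 \<le> sin x - x + x ^ 3 / 6"
      using sin_ge_cubic[of x] x by simp
    ultimately show "\<exists>d. (?f has_real_derivative d) (at x) \<and> 0 \<le> d" by blast
  qed
  then show ?thesis by simp
qed

lemma abs_sin_diff_le: "\<bar>sin y - y\<bar> \<le> \<bar>y\<bar> ^ 3 / 6" for y :: real
proof -
  have *: "\<bar>sin z - z\<bar> \<le> z ^ 3 / 6" if "0 \<le> z" for z :: real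
    using sin_ge_cubic[OF that] sin_x_le_x[OF that] that by (auto simp: abs_if)
  show ?thesis
  proof (cases "0 \<le> y")
    case True
    then show ?thesis using *[of y] by simp
  next
    case False
    then have "\<bar>sin (-y) - (-y)\<bar> \<le> (-y) ^ 3 / 6" by (intro *) simp
    then show ?thesis using False by (simp add: abs_minus_commute)
  qed
qed

text \<open>
  Modulus and argument of a factor of Euler's product:
  \<open>1/(1 - x e^{ib}) = e^{-damp + i phase} / (1 - x)\<close>.
\<close>

definition damp :: "real \<Rightarrow> real \<Rightarrow> real" where
  "damp x b = Re (Ln (1 - of_real x * cis b)) - ln (1 - x)"

definition phase :: "real \<Rightarrow> real \<Rightarrow> real" where
  "phase x b = - Im (Ln (1 - of_real x * cis b))"

text \<open>The closed form of \<open>\<Sum>j. x ^ j * (1 - cos (j b))\<close>.\<close>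

definition kern :: "real \<Rightarrow> real \<Rightarrow> real" where
  "kern x b = x * (1 + x) * (1 - cos b) / ((1 - x) * ((1 - x)\<^sup>2 + 2 * x * (1 - cos b)))"

context
  fixes x :: real
  assumes x: "0 \<le> x" "x < 1"
begin

lemma one_minus_cis_nonzero: "1 - of_real x * cis b \<noteq> 0"
proof
  assume "1 - of_real x * cis b = 0"
  then have "norm (of_real x * cis b) = 1" by (metis eq_iff_diff_eq_0 norm_one)
  then show False using x by (simp add: norm_mult)
qed

lemma geometric_factor_polar:
  "1 / (1 - of_real x * cis b) = of_real (1 / (1 - x)) * (of_real (exp (- damp x b)) * cis (phase x b))"
proof -
  let ?w = "1 - of_real x * cis b"
  have "1 / ?w = exp (- Ln ?w)"
    using one_minus_cis_nonzero[of b] by (simp add: exp_minus divide_inverse)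
  also have "\<dots> = of_real (exp (- Re (Ln ?w))) * cis (phase x b)"
    by (subst exp_eq_polar) (simp add: phase_def exp_of_real)
  also have "exp (- Re (Ln ?w)) = 1 / (1 - x) * exp (- damp x b)"
  proof -
    have "- Re (Ln ?w) = - ln (1 - x) + (- damp x b)" by (simp add: damp_def)
    then have "exp (- Re (Ln ?w)) = exp (- ln (1 - x)) * exp (- damp x b)"
      by (simp only: exp_add)
    then show ?thesis using x by (simp add: exp_minus divide_inverse)
  qed
  finally show ?thesis by simp
qed

lemma Ln_sums: "(\<lambda>n. - ((of_real x * cis b) ^ n) / of_nat n) sums Ln (1 - of_real x * cis b)"
  using Ln_series'[of "- (of_real x * cis b)"] x by (simp add: norm_mult)

lemma cis_power: "(of_real x * cis b) ^ n = of_real (x ^ n) * cis (real n * b)"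
  by (simp only: power_mult_distrib Complex.DeMoivre of_real_power)

text \<open>The terms for \<open>n = 0\<close> vanish, because \<open>x / 0 = 0\<close>.\<close>

lemma damp_sums: "(\<lambda>n. x ^ n * (1 - cos (real n * b)) / real n) sums damp x b"
proof -
  have 1: "(\<lambda>n. - (x ^ n * cos (real n * b)) / real n) sums Re (Ln (1 - of_real x * cis b))"
    using sums_Re[OF Ln_sums[of b]] by (simp add: cis_power)
  have "(\<lambda>n. - (x ^ n) / real n) sums Re (Ln (1 - of_real x))"
    using sums_Re[OF Ln_sums[of 0]] by (simp flip: of_real_power)
  moreover have "Re (Ln (1 - of_real x)) = ln (1 - x)"
    using x by (metis Re_complex_of_real Ln_of_real diff_gt_0_iff_gt of_real_1 of_real_diff)
  ultimately have "(\<lambda>n. - (x ^ n) / real n) sums ln (1 - x)" by simp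
  from sums_diff[OF 1 this] show ?thesis
    by (simp add: damp_def diff_divide_distrib algebra_simps flip: add_divide_distrib)
qed

lemma phase_sums: "(\<lambda>n. x ^ n * sin (real n * b) / real n) sums phase x b"
  using sums_minus[OF sums_Im[OF Ln_sums[of b]]] by (simp add: cis_power phase_def)

lemma damp_le: "damp x b \<le> b\<^sup>2 / 2 * (x / (1 - x)\<^sup>2)"
proof (rule sums_le[OF _ damp_sums sums_mult[OF geometric_moment_1[OF x]]])
  fix n
  show "x ^ n * (1 - cos (real n * b)) / real n \<le> b\<^sup>2 / 2 * (real n * x ^ n)"
  proof (cases "n = 0")
    case False
    have "x ^ n * (1 - cos (real n * b)) / real n \<le> x ^ n * ((real n * b)\<^sup>2 / 2) / real n"
      using x one_minus_cos_le[of "real n * b"] by (intro divide_right_mono mult_left_mono) auto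
    also have "\<dots> = b\<^sup>2 / 2 * (real n * x ^ n)"
      using False by (simp add: power2_eq_square)
    finally show ?thesis .
  qed simp
qed

text \<open>All terms of the series are nonnegative. Summed over the factors of the product, the two
  terms kept become kernels at \<open>r\<close> and \<open>r ^ 2\<close>.\<close>

lemma damp_ge: "x * (1 - cos b) + x\<^sup>2 * (1 - cos (2 * b)) / 2 \<le> damp x b"
proof -
  have "(\<Sum>n\<in>{1,2}. x ^ n * (1 - cos (real n * b)) / real n) \<le> damp x b"
    by (rule sum_le_sums[OF damp_sums]) (use x in auto)
  then show ?thesis by simp
qed

text \<open>The linear part of each sine adds up to the mean of the factor times \<open>b\<close>;
  at the saddle point these parts cancel against the rotation by \<open>n a\<close>, and only the
  cubic error remains.\<close>

lemma phase_diff_le: "\<bar>phase x b - b * (x / (1 - x))\<bar> \<le> \<bar>b\<bar> ^ 3 / 6 * (x * (1 + x) / (1 - x) ^ 3)"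
proof -
  let ?f = "\<lambda>n. x ^ n * sin (real n * b) / real n - b * ((if n = 0 then 0 else 1) * x ^ n)"
  let ?g = "\<lambda>n. \<bar>b\<bar> ^ 3 / 6 * (real n ^ 2 * x ^ n)"
  have f: "?f sums (phase x b - b * (x / (1 - x)))"
    by (intro sums_diff phase_sums sums_mult geometric_moment_0 x)
  have g: "?g sums (\<bar>b\<bar> ^ 3 / 6 * (x * (1 + x) / (1 - x) ^ 3))"
    by (intro sums_mult geometric_moment_2 x)
  have "norm (?f n) \<le> ?g n" for n
  proof (cases "n = 0")
    case False
    have "?f n = x ^ n / real n * (sin (real n * b) - real n * b)"
      using False by (simp add: field_simps)
    then have "norm (?f n) = x ^ n / real n * \<bar>sin (real n * b) - real n * b\<bar>"
      using x by (simp add: abs_mult)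
    also have "\<dots> \<le> x ^ n / real n * (\<bar>real n * b\<bar> ^ 3 / 6)"
      using x by (intro mult_left_mono abs_sin_diff_le) auto
    also have "\<dots> = ?g n"
      using False by (simp add: abs_mult power2_eq_square power3_eq_cube)
    finally show ?thesis .
  qed simp
  with f g show ?thesis
    by (metis (no_types, lifting) real_norm_def norm_suminf_le sums_iff)
qed

lemma kern_sums: "(\<lambda>j. x ^ j * (1 - cos (real j * b))) sums kern x b"
proof -
  have "norm (of_real x * cis b) < 1" using x by (simp add: norm_mult)
  from sums_Re[OF geometric_sums[OF this]]
  have 1: "(\<lambda>j. x ^ j * cos (real j * b)) sums Re (1 / (1 - of_real x * cis b))"
    by (simp add: cis_power)
  have 2: "(\<lambda>j. x ^ j) sums (1 / (1 - x))"
    using x by (intro geometric_sums) auto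
  let ?c = "cos b"
  have D: "(1 - x * ?c)\<^sup>2 + (x * sin b)\<^sup>2 = (1 - x)\<^sup>2 + 2 * x * (1 - ?c)" (is "?D = ?D'")
  proof -
    have "(x * sin b)\<^sup>2 = x\<^sup>2 * (1 - ?c\<^sup>2)" by (simp add: power_mult_distrib sin_squared_eq)
    then show ?thesis by (simp add: power2_eq_square algebra_simps)
  qed
  have pos: "?D' > 0" using x by (intro add_pos_nonneg) auto
  have "Re (1 / (1 - of_real x * cis b)) = (1 - x * ?c) / ?D"
    by (simp add: Re_divide)
  then have R: "Re (1 / (1 - of_real x * cis b)) = (1 - x * ?c) / ?D'" by (simp only: D)
  have "1 / (1 - x) - (1 - x * ?c) / ?D' = (?D' - (1 - x) * (1 - x * ?c)) / ((1 - x) * ?D')"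
    using x pos by (subst diff_frac_eq) auto
  also have "?D' - (1 - x) * (1 - x * ?c) = x * (1 + x) * (1 - ?c)"
    by (simp add: power2_eq_square algebra_simps)
  finally have "1 / (1 - x) - (1 - x * ?c) / ?D' = kern x b" unfolding kern_def .
  with sums_diff[OF 2 1] show ?thesis unfolding R by (simp add: algebra_simps)
qed

text \<open>Each omitted term is at most \<open>2 * x ^ j\<close>; the term for \<open>j = 0\<close>
  vanishes, so it does not matter that the sum starts at 1.\<close>

lemma kern_partial: "kern x b - 2 * x ^ (M + 1) / (1 - x) \<le> (\<Sum>j=1..M. x ^ j * (1 - cos (real j * b)))"
proof -
  let ?f = "\<lambda>j. x ^ j * (1 - cos (real j * b))"
  have A: "(\<lambda>j. ?f (j + (M + 1))) sums (kern x b - (\<Sum>j<M + 1. ?f j))"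
    by (rule sums_split_initial_segment[OF kern_sums])
  have B: "(\<lambda>j. 2 * x ^ (M + 1) * x ^ j) sums (2 * x ^ (M + 1) * (1 / (1 - x)))"
    using x by (intro sums_mult geometric_sums) auto
  have C: "?f (j + (M + 1)) \<le> 2 * x ^ (M + 1) * x ^ j" for j
  proof -
    have "?f (j + (M + 1)) \<le> x ^ (j + (M + 1)) * 2"
    proof (rule mult_left_mono)
      show "1 - cos (real (j + (M + 1)) * b) \<le> 2"
        using cos_ge_minus_one[of "real (j + (M + 1)) * b"] by linarith
    qed (use x in simp)
    then show ?thesis by (simp add: power_add mult_ac)
  qed
  have "kern x b - (\<Sum>j<M + 1. ?f j) \<le> 2 * x ^ (M + 1) * (1 / (1 - x))"
    by (rule sums_le[OF C A B])
  moreover have "(\<Sum>j<M + 1. ?f j) = (\<Sum>j=1..M. ?f j)"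
    by (rule sum.mono_neutral_right) (auto simp: not_le)
  ultimately show ?thesis by simp
qed

end

section \<open>A lower bound for the kernel\<close>

lemma exp_coth_bound:
  fixes y :: real
  assumes "0 < y"
  shows "2 / y \<le> (1 + exp (-y)) / (1 - exp (-y))"
proof -
  let ?f = "\<lambda>y :: real. (2 + y) * exp (-y) - 2 + y"
  have "?f 0 \<le> ?f y"
  proof (rule DERIV_nonneg_imp_nondecreasing[of 0 y])
    fix x :: real assume x: "0 \<le> x" "x \<le> y"
    have "(?f has_real_derivative (1 - (1 + x) * exp (-x))) (at x)"
      by (auto intro!: derivative_eq_intros simp: algebra_simps)
    moreover have "(1 + x) * exp (-x) \<le> 1"
      using exp_ge_add_one_self[of x] by (simp add: exp_minus field_simps)
    ultimately show "\<exists>d. (?f has_real_derivative d) (at x) \<and> 0 \<le> d" by force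
  qed (use assms in simp)
  then show ?thesis using assms by (simp add: field_simps)
qed

text \<open>With \<open>h\<close> close to \<open>y\<^sup>2\<close> and
  \<open>S = 2 * (1 - cos b)\<close> close to \<open>(u * y)\<^sup>2\<close>, the kernel is
  \<open>coth (y / 2) / 2 * (S / (h + S))\<close>, roughly
  \<open>1 / y * (u\<^sup>2 / (1 + u\<^sup>2))\<close>; 51/50 pays for both approximations. As
  \<open>b\<close> enters only through its cosine, angles beyond \<open>u * y\<close> are covered
  too. The range of \<open>y\<close> allows \<open>y = 2 * t\<close> with
  \<open>t \<le> 1/30\<close>.\<close>

lemma kern_exp_ge:
  fixes y :: real
  assumes y: "0 < y" "y \<le> 1 / 15" and u: "0 \<le> u" "u \<le> 2"
    and c: "cos b \<le> cos (u * y)"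
  shows "1 / y * (u\<^sup>2 / (51/50 + u\<^sup>2)) \<le> kern (exp (-y)) b"
proof -
  define x where "x = exp (-y)"
  define h where "h = (1 - x)\<^sup>2 / x"
  define S where "S = 2 * (1 - cos b)"
  have x: "0 < x" "x < 1" using y by (auto simp: x_def)
  have h: "h > 0" using x by (simp add: h_def)
  have coth: "2 / y \<le> (1 + x) / (1 - x)" unfolding x_def by (rule exp_coth_bound[OF y(1)])
  \<comment> \<open>The square of the left side of the identity below is \<open>coth (y / 2)\<close>
    squared, so the bound \<open>coth\<close> turns into
    \<open>4 / y\<^sup>2 \<le> 1 + 4 / h\<close>.\<close>
  have hy: "h \<le> 501/500 * y\<^sup>2"
  proof -
    have "((1 + x) / (1 - x))\<^sup>2 = 1 + 4 / h"
    proof -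
      have "1 + 4 / h = ((1 - x)\<^sup>2 + 4 * x) / (1 - x)\<^sup>2"
        using x by (simp add: h_def add_divide_distrib)
      also have "(1 - x)\<^sup>2 + 4 * x = (1 + x)\<^sup>2"
        by (simp add: power2_eq_square algebra_simps)
      finally show ?thesis by (simp add: power_divide)
    qed
    moreover have "(2 / y)\<^sup>2 \<le> ((1 + x) / (1 - x))\<^sup>2"
      using coth y by (intro power_mono) auto
    ultimately have "4 / y\<^sup>2 - 1 \<le> 4 / h" by (simp add: power_divide)
    then have "h * (4 - y\<^sup>2) \<le> 4 * y\<^sup>2" using h y by (simp add: field_simps)
    moreover have "y\<^sup>2 \<le> (1/15)\<^sup>2" using y by (intro power_mono) auto
    then have "h * (4 - 1/225) \<le> h * (4 - y\<^sup>2)" using h by (intro mult_left_mono) (auto simp: power2_eq_square)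
    ultimately have "h * (4 - 1/225) \<le> 4 * y\<^sup>2" by linarith
    then have "h \<le> 900/899 * y\<^sup>2" by simp
    also have "\<dots> \<le> 501/500 * y\<^sup>2" by (intro mult_right_mono) auto
    finally show ?thesis .
  qed
  have S: "S \<ge> 499/500 * (u * y)\<^sup>2"
  proof -
    let ?b = "u * y"
    have b: "0 \<le> ?b" "?b \<le> 2/15"
      using u y mult_mono[OF u(2) y(2)] by simp_all
    have "cos ?b \<le> 1 - ?b\<^sup>2 / 2 + ?b ^ 4 / 24" using b by (intro cos_le_quartic)
    moreover have "?b ^ 4 \<le> 4/225 * ?b\<^sup>2"
    proof -
      have "?b ^ 4 = ?b\<^sup>2 * ?b\<^sup>2" by (simp add: power2_eq_square power4_eq_xxxx)
      also have "\<dots> \<le> ?b\<^sup>2 * (2/15)\<^sup>2" using b by (intro mult_left_mono power_mono) auto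
      also have "\<dots> = 4/225 * ?b\<^sup>2" by (simp add: power2_eq_square)
      finally show ?thesis .
    qed
    ultimately have "499/500 * z \<le> 2 * (1 - cos b)" if "?b\<^sup>2 = z" for z
      using c zero_le_power2[of ?b] unfolding that by (simp add: field_simps)
    then show ?thesis unfolding S_def by simp
  qed
  have S0: "S \<ge> 0" by (simp add: S_def)
  have half: "(v / 2) / z = 1 / 2 * (v / z)" "1 / y * v = 2 / y * (1 / 2 * v)" for v z :: real by simp_all
  have eq: "kern x b = (1 + x) / (1 - x) * (1 / 2 * (S / (h + S)))"
  proof -
    have c: "1 - cos b = S / 2" by (simp add: S_def)
    have "(1 - x)\<^sup>2 + 2 * x * (S / 2) = x * (h + S)"
      using x by (simp add: h_def distrib_left)
    then have "kern x b = x * (1 + x) * (S / 2) / ((1 - x) * (x * (h + S)))"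
      unfolding kern_def c by (simp only:)
    also have "\<dots> = x * ((1 + x) * (S / 2)) / (x * ((1 - x) * (h + S)))"
      by (simp only: mult_ac)
    also have "\<dots> = (1 + x) * (S / 2) / ((1 - x) * (h + S))"
      using x by (subst mult_divide_mult_cancel_left) auto
    finally show ?thesis by (simp only: times_divide_times_eq[symmetric] half(1))
  qed
  have frac: "u\<^sup>2 / (51/50 + u\<^sup>2) \<le> S / (h + S)"
  proof -
    have "u\<^sup>2 * h \<le> u\<^sup>2 * (501/500 * y\<^sup>2)"
      by (intro mult_left_mono hy) simp
    also have "\<dots> \<le> 51/50 * (499/500 * (u * y)\<^sup>2)"
      by (simp add: power_mult_distrib)
    also have "\<dots> \<le> 51/50 * S" using S by simp
    finally have "u\<^sup>2 * h \<le> 51/50 * S" .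
    then have "u\<^sup>2 * (h + S) \<le> S * (51/50 + u\<^sup>2)" by (simp add: algebra_simps)
    moreover have "h + S > 0" "51/50 + u\<^sup>2 > 0"
      using h S0 by (auto intro: add_pos_nonneg)
    ultimately show ?thesis by (simp add: pos_divide_le_eq pos_le_divide_eq mult_ac)
  qed
  have "1 / y * (u\<^sup>2 / (51/50 + u\<^sup>2)) \<le> 1 / y * (S / (h + S))"
    using y by (intro mult_left_mono frac) auto
  also have "\<dots> = 2 / y * (1 / 2 * (S / (h + S)))" by (rule half(2))
  also have "\<dots> \<le> (1 + x) / (1 - x) * (1 / 2 * (S / (h + S)))"
    using coth S0 h by (intro mult_right_mono) auto
  also have "\<dots> = kern x b" unfolding eq ..
  finally show ?thesis unfolding x_def .
qed

section \<open>Positivity of the saddle point integral\<close>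

lemma integral_ge_FTC:
  fixes f F g :: "real \<Rightarrow> real"
  assumes "a \<le> b" and cont: "continuous_on {a..b} f"
    and deriv: "\<And>x. a \<le> x \<Longrightarrow> x \<le> b \<Longrightarrow> (F has_real_derivative g x) (at x)"
    and le: "\<And>x. a \<le> x \<Longrightarrow> x \<le> b \<Longrightarrow> g x \<le> f x"
  shows "F b - F a \<le> integral {a..b} f"
proof -
  have "(g has_integral (F b - F a)) {a..b}"
  proof (rule fundamental_theorem_of_calculus[OF assms(1)])
    fix x assume "x \<in> {a..b}"
    then have "(F has_real_derivative g x) (at x)" by (intro deriv) auto
    then have "(F has_real_derivative g x) (at x within {a..b})"
      by (rule has_field_derivative_at_within)
    then show "(F has_vector_derivative g x) (at x within {a..b})"
      by (simp only: has_real_derivative_iff_has_vector_derivative)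
  qed
  moreover have "(f has_integral integral {a..b} f) {a..b}"
    using integrable_continuous_interval[OF cont] by (rule integrable_integral)
  ultimately show ?thesis
    by (rule has_integral_le) (use le in auto)
qed

text \<open>A certificate for numerical bounds: \<open>exp x\<close> is the 64th power of
  \<open>exp (x / 64)\<close>, taken as two eighth powers. The witnesses \<open>a\<close> and
  \<open>b\<close> are rounded-down decimals for \<open>exp (x / 64)\<close> and its eighth power,
  which keeps the numerals short.\<close>

lemma exp_neg_le:
  fixes x a b c :: real
  assumes "0 \<le> x" "0 \<le> a" "0 \<le> b" "0 < c"
    and "a \<le> 1 + x / 64 + (x / 64)\<^sup>2 / 2" "b \<le> a ^ 8" "1 \<le> c * b ^ 8"
  shows "exp (-x) \<le> c"
proof -
  have "a \<le> exp (x / 64)"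
    using exp_lower_Taylor_quadratic[of "x / 64"] assms by linarith
  then have "a ^ 8 \<le> exp (x / 64) ^ 8"
    using assms by (intro power_mono)
  with assms have "b \<le> exp (x / 64) ^ 8" by linarith
  then have "b ^ 8 \<le> (exp (x / 64) ^ 8) ^ 8"
    using assms by (intro power_mono)
  also have "\<dots> = exp x" by (simp flip: power_mult exp_of_nat_mult)
  finally have "c * b ^ 8 \<le> c * exp x" using assms by (intro mult_left_mono) auto
  with assms have "1 \<le> c * exp x" by linarith
  then show ?thesis by (simp add: exp_minus field_simps)
qed

text \<open>Equality holds at \<open>t = 1/30\<close>. The condition
  \<open>k \<le> 30 * \<beta>\<close> makes \<open>exp (- (\<beta> / t)) / t ^ k\<close> increasing
  up to that point.\<close>

lemma exp_decay_power:
  fixes t \<beta> :: real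
  assumes t: "0 < t" "t \<le> 1 / 30" and k: "0 < k" "real k \<le> 30 * \<beta>"
  shows "exp (- (\<beta> / t)) \<le> exp (- (30 * \<beta>)) * (30 * t) ^ k"
proof -
  define x where "x = \<beta> / t - 30 * \<beta>"
  have "1 / (30 * t) - 1 \<le> (30 * \<beta> / k) * (1 / (30 * t) - 1)"
    using k t mult_right_mono[of 1 "30 * \<beta> / k" "1 / (30 * t) - 1"] by (simp add: field_simps)
  also have "\<dots> = x / k"
    using k t by (simp add: x_def field_simps)
  finally have "1 / (30 * t) \<le> 1 + x / k" by simp
  also have "\<dots> \<le> exp (x / k)" by (rule exp_ge_add_one_self)
  finally have "(1 / (30 * t)) ^ k \<le> exp (x / k) ^ k"
    using t by (intro power_mono) auto
  also have "\<dots> = exp x" using k by (simp flip: exp_of_nat_mult)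
  finally have "exp (-x) \<le> (30 * t) ^ k"
    using t by (simp add: exp_minus power_one_over field_simps)
  then have "exp (- (30 * \<beta>)) * exp (-x) \<le> exp (- (30 * \<beta>)) * (30 * t) ^ k"
    by (rule mult_left_mono) simp
  then show ?thesis by (simp add: x_def flip: exp_add)
qed

text \<open>
  In the scaled variable \<open>s = a / t^{3/2}\<close> the integrand near the saddle point is at least
  \<open>s^2 e^{-4\<alpha>s^2} cos(\<kappa>s^3) / 2\<close> with \<open>\<alpha> = 1.645/4\<close> and \<open>\<kappa>^2/2 \<le> \<beta>\<close>, up to a factor close to 1;
  \<open>main_prim\<close> is the primitive of the polynomial bound obtained from \<open>e^{-4y} \<ge> (1 - y)^4\<close> and
  \<open>cos y \<ge> 1 - y^2/2\<close>.
\<close>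

definition main_prim :: "real \<Rightarrow> real" where
  "main_prim s = (let \<alpha> = 329/800; \<beta> = 547/10000 in
     s^3/3 - 4*\<alpha>* s^5/5 + 6*\<alpha>^2* s^7/7 - 4*\<alpha>^3* s^9/9 + \<alpha>^4* s^11/11
     - \<beta> * (s^9/9 - 4*\<alpha>* s^11/11 + 6*\<alpha>^2* s^13/13 - 4*\<alpha>^3* s^15/15 + \<alpha>^4* s^17/17))"

lemma main_prim_deriv:
  "(main_prim has_real_derivative s\<^sup>2 * (1 - 329/800 * s\<^sup>2) ^ 4 * (1 - 547/10000 * s ^ 6)) (at s)"
proof -
  have expand: "s\<^sup>2 * (1 - \<alpha> * s\<^sup>2) ^ 4 * (1 - \<beta> * s ^ 6) =
     s^2 - 4*\<alpha>* s^4 + 6*\<alpha>^2* s^6 - 4*\<alpha>^3* s^8 + \<alpha>^4* s^10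
     - \<beta> * (s^8 - 4*\<alpha>* s^10 + 6*\<alpha>^2* s^12 - 4*\<alpha>^3* s^14 + \<alpha>^4* s^16)" for \<alpha> \<beta> :: real
    by algebra
  show ?thesis
    unfolding expand main_prim_def Let_def
    by (auto intro!: derivative_eq_intros simp: field_simps)
qed

lemma main_prim_value: "main_prim 0 = 0" "1365/10000 \<le> main_prim (3/2)"
  by (simp_all add: main_prim_def Let_def power_divide)

text \<open>The additional term \<open>1/s^2\<close> in the derivative makes the Gaussian tail integrable in closed form.\<close>

definition gauss_prim :: "real \<Rightarrow> real" where
  "gauss_prim s = - ((5/9) * s + (25/81) / s) * exp (- (9/10 * s\<^sup>2))"

lemma gauss_prim_deriv:
  assumes "s > 0"
  shows "(gauss_prim has_real_derivative (s\<^sup>2 + 25/81 / s\<^sup>2) * exp (- (9/10 * s\<^sup>2))) (at s)"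
  unfolding gauss_prim_def using assms
  by (auto intro!: derivative_eq_intros simp: field_simps power2_eq_square)


lemma gauss_prim_nonpos:
  assumes "0 < s"
  shows "gauss_prim s \<le> 0"
proof -
  have "0 \<le> ((5/9) * s + (25/81) / s) * exp (- (9/10 * s\<^sup>2))"
    using assms by (intro mult_nonneg_nonneg add_nonneg_nonneg) auto
  then show ?thesis by (simp only: gauss_prim_def mult_minus_left neg_le_0_iff_le)
qed

text \<open>The interval is cut at \<open>3/2 * \<tau>\<close>, \<open>5/3 * \<tau>\<close>,
  \<open>3/5 * t\<close> and \<open>2 * t\<close>, where \<open>\<tau> = t powr (3/2)\<close> is the
  width of the peak. The first piece yields at least \<open>0.068 * \<tau> ^ 3\<close> and the
  second is nonnegative; on the others absolute values cost at most 0.0462, 0.0140 and 0.0030 times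
  \<open>\<tau> ^ 3\<close>.\<close>

lemma saddle_integral_pos:
  fixes R \<phi> :: "real \<Rightarrow> real" and t :: real
  assumes t: "0 < t" "t \<le> 1 / 30"
    and cont: "continuous_on {0..pi} R" "continuous_on {0..pi} \<phi>"
    and R_le: "\<And>a. 0 \<le> a \<Longrightarrow> a \<le> pi \<Longrightarrow> R a \<le> 329/200 * a\<^sup>2 / t ^ 3"
    and \<phi>_le: "\<And>a. 0 \<le> a \<Longrightarrow> a \<le> pi \<Longrightarrow> \<bar>\<phi> a\<bar> \<le> 181/100 * a ^ 3 / t ^ 4"
    and R_ge1: "\<And>a. 0 \<le> a \<Longrightarrow> a \<le> 3/5 * t \<Longrightarrow> 9/10 * a\<^sup>2 / t ^ 3 - 1/100 \<le> R a"
    and R_ge2: "\<And>a. 3/5 * t \<le> a \<Longrightarrow> a \<le> 2 * t \<Longrightarrow> 81/250 / t - 1/100 \<le> R a"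
    and R_ge3: "\<And>a. 2 * t \<le> a \<Longrightarrow> a \<le> pi \<Longrightarrow> 199/250 / t - 1/100 \<le> R a"
  shows "0 < integral {0..pi} (\<lambda>a. exp (- R a) * cos (\<phi> a) * (1 - cos a))"
proof -
  define f where "f a = exp (- R a) * cos (\<phi> a) * (1 - cos a)" for a
  define q where "q = sqrt t"
  define \<tau> where "\<tau> = q ^ 3"
  \<comment> \<open>\<open>E\<close> is the price of the slack 1/100 in the lower bounds for
    \<open>R\<close>.\<close>
  define E where "E = exp (1/100 :: real)"
  have q: "0 < q" "t = q\<^sup>2" using t by (auto simp: q_def)
  have q_le: "q \<le> 1826/10000"
    unfolding q_def by (rule real_le_lsqrt) (use t in \<open>simp_all add: power2_eq_square\<close>)
  have \<tau>: "0 < \<tau>" "\<tau>\<^sup>2 = t ^ 3" "\<tau> = t * q" "\<tau> ^ 3 = t ^ 4 * q"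
    using q by (auto simp: \<tau>_def power_mult[symmetric] power2_eq_square power3_eq_cube power4_eq_xxxx)
  have E: "0 < E" "E \<le> 10101/10000"
    using exp_bound[of "1/100"] by (auto simp: E_def power2_eq_square)
  have \<tau>_le: "5/3 * \<tau> \<le> 3/5 * t"
  proof -
    have "5/3 * \<tau> = t * (5/3 * q)" by (simp add: \<tau>(3))
    also have "\<dots> \<le> t * (3/5)" using q_le t by (intro mult_left_mono) auto
    finally show ?thesis by simp
  qed
  have pi3: "3 < pi" using pi_gt3 .
  have ord: "0 \<le> 3/2 * \<tau>" "3/2 * \<tau> \<le> 5/3 * \<tau>" "3/5 * t \<le> 2 * t" "2 * t \<le> pi"
    using \<tau>(1) t pi3 by auto
  have contf: "continuous_on {0..pi} f"
    unfolding f_def by (intro continuous_intros cont)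
  have contf': "continuous_on {a..b} f" if "0 \<le> a" "b \<le> pi" for a b
    by (rule continuous_on_subset[OF contf]) (use that in auto)
  have int: "f integrable_on {a..b}" if "0 \<le> a" "b \<le> pi" for a b
    by (rule integrable_continuous_interval[OF contf'[OF that]])
  have f_ge: "- (exp (- R a) * (1 - cos a)) \<le> f a" for a
  proof -
    have "exp (- R a) * (1 - cos a) * (-1) \<le> exp (- R a) * (1 - cos a) * cos (\<phi> a)"
      by (intro mult_left_mono) auto
    then show ?thesis by (simp add: f_def mult_ac)
  qed
  have f_ge': "- (c * d) \<le> f a" if "exp (- R a) \<le> c" "1 - cos a \<le> d" for a c d
  proof -
    have "exp (- R a) * (1 - cos a) \<le> c * d"
      using that by (intro mult_mono) (auto intro: order_trans[OF less_imp_le[OF exp_gt_zero]])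
    then show ?thesis using f_ge[of a] by linarith
  qed
  have exp_le: "exp (- R a) \<le> E * exp (- z)" if "z - 1/100 \<le> R a" for a z
    using that by (simp add: E_def flip: exp_add)
  \<comment> \<open>In the variable \<open>a / \<tau>\<close> the cubic phase bound keeps a factor
    \<open>q\<close>, which is at most \<open>sqrt (1/30)\<close>; 33052/100000 rounds up the
    product of 181/100 and 1826/10000.\<close>
  have \<phi>_scaled: "\<bar>\<phi> a\<bar> \<le> 33052/100000 * (a / \<tau>) ^ 3" if "0 \<le> a" "a \<le> pi" for a
  proof -
    have "\<bar>\<phi> a\<bar> \<le> 181/100 * a ^ 3 / t ^ 4" using \<phi>_le[OF that] .
    also have "\<dots> = 181/100 * q * (a / \<tau>) ^ 3"
      using q(1) t by (simp add: power_divide \<tau>(4))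
    also have "\<dots> \<le> 33052/100000 * (a / \<tau>) ^ 3"
      using q_le that \<tau> by (intro mult_right_mono) auto
    finally show ?thesis .
  qed

  have scale: "c * \<tau> ^ 3 * (v * (1 / \<tau>)) = c * \<tau> ^ 2 * v" for c v
    using \<tau>(1) by (simp add: power2_eq_square power3_eq_cube)

  \<comment> \<open>On the peak \<open>1 - cos a\<close> is at least
    \<open>999/2000 * a\<^sup>2\<close>, a little below \<open>a\<^sup>2 / 2\<close> to absorb the
    quartic term. The remaining factors become the derivative of \<open>main_prim\<close> at
    \<open>a / \<tau>\<close>.\<close>
  have A: "999/2000 * \<tau> ^ 3 * (1365/10000) \<le> integral {0..3/2 * \<tau>} f"
  proof -
    let ?F = "\<lambda>a. 999/2000 * \<tau> ^ 3 * main_prim (a / \<tau>)"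
    let ?g = "\<lambda>a. 999/2000 * \<tau> ^ 2 * ((a / \<tau>)\<^sup>2 * (1 - 329/800 * (a / \<tau>)\<^sup>2) ^ 4 * (1 - 547/10000 * (a / \<tau>) ^ 6))"
    have "?F (3/2 * \<tau>) - ?F 0 \<le> integral {0..3/2 * \<tau>} f"
    proof (rule integral_ge_FTC)
      fix a assume a: "0 \<le> a" "a \<le> 3/2 * \<tau>"
      define s where "s = a / \<tau>"
      have "((\<lambda>a. a / \<tau>) has_real_derivative 1 / \<tau>) (at a)"
        using \<tau>(1) by (auto intro!: derivative_eq_intros)
      from DERIV_chain2[OF main_prim_deriv this]
      have "(?F has_real_derivative 999/2000 * \<tau> ^ 3 *
         ((a / \<tau>)\<^sup>2 * (1 - 329/800 * (a / \<tau>)\<^sup>2) ^ 4 * (1 - 547/10000 * (a / \<tau>) ^ 6) * (1 / \<tau>))) (at a)"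
        by (rule DERIV_cmult)
      then show "(?F has_real_derivative ?g a) (at a)"
        by (simp only: scale)
      have s: "0 \<le> s" "s \<le> 3/2" "a = \<tau> * s"
        using a \<tau>(1) by (simp_all add: s_def pos_divide_le_eq)
      have s2: "s\<^sup>2 \<le> (3/2)\<^sup>2" and s6: "s ^ 6 \<le> (3/2) ^ 6"
        using s by (auto intro: power_mono)
      have a_pi: "a \<le> pi" using a ord \<tau>_le by linarith
      have e: "(1 - 329/800 * s\<^sup>2) ^ 4 \<le> exp (- R a)"
      proof -
        have "R a \<le> 329/200 * s\<^sup>2"
          using R_le[OF a(1) a_pi] \<tau> by (simp add: s_def power_divide)
        then have "exp (- (329/200 * s\<^sup>2)) \<le> exp (- R a)" by simp
        moreover have "(1 - 329/800 * s\<^sup>2) ^ 4 \<le> exp (- (329/800 * s\<^sup>2)) ^ 4"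
          using s2 exp_ge_add_one_self[of "- (329/800 * s\<^sup>2)"]
          by (intro power_mono) (auto simp: power2_eq_square)
        moreover have "exp (- (329/800 * s\<^sup>2)) ^ 4 = exp (- (329/200 * s\<^sup>2))"
          by (simp flip: exp_of_nat_mult)
        ultimately show ?thesis by linarith
      qed
      have c: "1 - 547/10000 * s ^ 6 \<le> cos (\<phi> a)"
      proof -
        have "(\<phi> a)\<^sup>2 \<le> (33052/100000 * s ^ 3)\<^sup>2"
          using \<phi>_scaled[OF a(1) a_pi] by (intro abs_le_square_iff[THEN iffD1]) (auto simp: s_def)
        also have "\<dots> \<le> 2 * (547/10000 * s ^ 6)"
          using s(1) by (simp add: power_mult_distrib flip: power_mult) (simp add: power2_eq_square)
        finally show ?thesis using one_minus_cos_le[of "\<phi> a"] by linarith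
      qed
      have d: "999/2000 * a\<^sup>2 \<le> 1 - cos a"
      proof -
        have "a \<le> 1/10" using a(2) \<tau>_le t by linarith
        then have "a\<^sup>2 \<le> (1/10)\<^sup>2" using a by (intro power_mono) auto
        then have "a\<^sup>2 * a\<^sup>2 \<le> a\<^sup>2 * (1/100)" by (intro mult_left_mono) (auto simp: power2_eq_square)
        then have "a ^ 4 \<le> a\<^sup>2 * (1/100)" by (simp add: power_numeral_reduce power2_eq_square mult.assoc)
        then have "a ^ 4 / 24 \<le> 1/2000 * a\<^sup>2" using zero_le_power2[of a] by linarith
        then show ?thesis using cos_le_quartic[OF a(1)] by (simp add: field_simps)
      qed
      have c0: "0 \<le> 1 - 547/10000 * s ^ 6" using s6 by (simp add: power_divide)
      have a2: "a\<^sup>2 = \<tau>\<^sup>2 * s\<^sup>2"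
        by (subst s(3)) (rule power_mult_distrib)
      have "?g a = (1 - 329/800 * s\<^sup>2) ^ 4 * (1 - 547/10000 * s ^ 6) * (999/2000 * a\<^sup>2)"
        by (simp only: s_def[symmetric] a2 mult_ac)
      also have "\<dots> \<le> exp (- R a) * cos (\<phi> a) * (1 - cos a)"
        using c0 by (intro mult_mono e c d) (auto intro: mult_nonneg_nonneg order_trans[OF c0 c])
      finally show "?g a \<le> f a" by (simp add: f_def)
    qed (use ord \<tau>_le contf' in auto)
    moreover have "?F (3/2 * \<tau>) - ?F 0 \<ge> 999/2000 * \<tau> ^ 3 * (1365/10000)"
      using main_prim_value \<tau>(1) by simp
    ultimately show ?thesis by linarith
  qed

  \<comment> \<open>Up to \<open>5/3 * \<tau>\<close> the phase stays below \<open>pi / 2\<close>,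
    so the cosine is still nonnegative.\<close>
  have B: "0 \<le> integral {3/2 * \<tau>..5/3 * \<tau>} f"
  proof (rule Henstock_Kurzweil_Integration.integral_nonneg)
    show "f integrable_on {3/2 * \<tau>..5/3 * \<tau>}" by (rule int) (use ord \<tau>_le in auto)
    fix a assume a: "a \<in> {3/2 * \<tau>..5/3 * \<tau>}"
    then have a': "0 \<le> a" "a \<le> pi" using ord \<tau>_le by auto
    have "a / \<tau> \<le> 5/3" "0 \<le> a / \<tau>" using a \<tau>(1) a' by (auto simp: field_simps)
    then have "(a / \<tau>) ^ 3 \<le> (5/3) ^ 3" by (intro power_mono)
    then have "\<bar>\<phi> a\<bar> \<le> 157/100"
      using \<phi>_scaled[OF a'] by (simp add: power_divide)
    moreover have "157/100 \<le> pi / 2" using pi_approx by simp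
    ultimately have "0 \<le> cos (\<phi> a)" by (intro cos_ge_zero) auto
    then show "0 \<le> f a" by (simp add: f_def)
  qed

  \<comment> \<open>The Gaussian tail from \<open>s = 5/3\<close>: there the exponent is
    \<open>9/10 * (5/3)\<^sup>2 = 5/2\<close>, and the prefactor of \<open>gauss_prim\<close> is
    10/9.\<close>
  have C: "- (E / 2 * \<tau> ^ 3 * (10/9 * exp (- (5/2)))) \<le> integral {5/3 * \<tau>..3/5 * t} f"
  proof -
    let ?F = "\<lambda>a. - (E / 2 * \<tau> ^ 3 * gauss_prim (a / \<tau>))"
    let ?g = "\<lambda>a. - (E / 2 * \<tau> ^ 2 * (((a / \<tau>)\<^sup>2 + 25/81 / (a / \<tau>)\<^sup>2) * exp (- (9/10 * (a / \<tau>)\<^sup>2))))"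
    have "?F (3/5 * t) - ?F (5/3 * \<tau>) \<le> integral {5/3 * \<tau>..3/5 * t} f"
    proof (rule integral_ge_FTC)
      fix a assume a: "5/3 * \<tau> \<le> a" "a \<le> 3/5 * t"
      then have a0: "0 < a" using \<tau>(1) by (smt (verit) mult_pos_pos divide_pos_pos)
      then have s: "0 < a / \<tau>" using \<tau>(1) by simp
      have "((\<lambda>a. a / \<tau>) has_real_derivative 1 / \<tau>) (at a)"
        using \<tau>(1) by (auto intro!: derivative_eq_intros)
      from DERIV_chain2[OF gauss_prim_deriv[OF s] this]
      have "(?F has_real_derivative - (E / 2 * \<tau> ^ 3 *
         (((a / \<tau>)\<^sup>2 + 25/81 / (a / \<tau>)\<^sup>2) * exp (- (9/10 * (a / \<tau>)\<^sup>2)) * (1 / \<tau>)))) (at a)"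
        by (intro DERIV_minus DERIV_cmult)
      then show "(?F has_real_derivative ?g a) (at a)"
        by (simp only: scale)
      define w where "w = exp (- (9/10 * (a / \<tau>)\<^sup>2))"
      have "exp (- R a) \<le> E * w"
        unfolding w_def by (rule exp_le) (use R_ge1[of a] a a0 \<tau>(2) in \<open>simp add: power_divide\<close>)
      then have "- (E * w * (a\<^sup>2 / 2)) \<le> f a"
        by (rule f_ge') (rule one_minus_cos_le)
      moreover have "?g a \<le> - (E * w * (a\<^sup>2 / 2))"
      proof -
        have "E / 2 * \<tau> ^ 2 * ((a / \<tau>)\<^sup>2 * w) \<le> E / 2 * \<tau> ^ 2 * (((a / \<tau>)\<^sup>2 + 25/81 / (a / \<tau>)\<^sup>2) * w)"
          using E(1) by (intro mult_left_mono mult_right_mono) (auto simp: w_def)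
        moreover have "E / 2 * \<tau> ^ 2 * ((a / \<tau>)\<^sup>2 * w) = E * w * (a\<^sup>2 / 2)"
          using \<tau>(1) by (simp add: power_divide)
        ultimately show ?thesis unfolding w_def by linarith
      qed
      ultimately show "?g a \<le> f a" by linarith
    qed (use ord \<tau>_le contf' in auto)
    moreover have "gauss_prim (3/5 * t / \<tau>) \<le> 0"
      using t \<tau>(1) by (intro gauss_prim_nonpos) simp
    then have "?F (3/5 * t) \<ge> 0" using E(1) \<tau>(1) by (simp add: mult_le_0_iff)
    moreover have "gauss_prim (5/3) = - (10/9 * exp (- (5/2)))"
      by (simp add: gauss_prim_def power2_eq_square)
    then have "?F (5/3 * \<tau>) = E / 2 * \<tau> ^ 3 * (10/9 * exp (- (5/2)))"
      using \<tau>(1) by simp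
    ultimately show ?thesis by linarith
  qed

  have D: "- (E * exp (- (81/250 / t)) * (4/3 * t ^ 3)) \<le> integral {3/5 * t..2 * t} f"
  proof -
    let ?c = "E * exp (- (81/250 / t))"
    let ?F = "\<lambda>a. - (?c * (a ^ 3 / 6))"
    have "?F (2 * t) - ?F (3/5 * t) \<le> integral {3/5 * t..2 * t} f"
    proof (rule integral_ge_FTC)
      fix a assume a: "3/5 * t \<le> a" "a \<le> 2 * t"
      show "(?F has_real_derivative - (?c * (a\<^sup>2 / 2))) (at a)"
        by (auto intro!: derivative_eq_intros simp: power2_eq_square)
      show "- (?c * (a\<^sup>2 / 2)) \<le> f a"
        by (rule f_ge'[OF exp_le one_minus_cos_le]) (rule R_ge2[OF a])
    qed (use ord t contf' in auto)
    moreover have "?F (2 * t) = - (?c * (4/3 * t ^ 3))" by (simp add: power_mult_distrib)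
    moreover have "?F (3/5 * t) \<le> 0" using E(1) t by simp
    ultimately show ?thesis by linarith
  qed

  have E': "- (E * exp (- (199/250 / t)) * (2 * pi)) \<le> integral {2 * t..pi} f"
  proof -
    let ?c = "E * exp (- (199/250 / t))"
    let ?F = "\<lambda>a. - (?c * (2 * a))"
    have "?F pi - ?F (2 * t) \<le> integral {2 * t..pi} f"
    proof (rule integral_ge_FTC)
      fix a assume a: "2 * t \<le> a" "a \<le> pi"
      show "(?F has_real_derivative - (?c * 2)) (at a)"
        by (auto intro!: derivative_eq_intros)
      have "1 - cos a \<le> 2" using cos_ge_minus_one[of a] by linarith
      then show "- (?c * 2) \<le> f a"
        by (rule f_ge'[OF exp_le[OF R_ge3[OF a]]])
    qed (use ord t contf' in auto)
    moreover have "?F (2 * t) \<le> 0" using E(1) t by simp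
    ultimately show ?thesis by linarith
  qed

  have split: "integral {0..pi} f = integral {0..3/2 * \<tau>} f + integral {3/2 * \<tau>..5/3 * \<tau>} f
     + integral {5/3 * \<tau>..3/5 * t} f + integral {3/5 * t..2 * t} f + integral {2 * t..pi} f"
  proof -
    have "integral {0..pi} f = integral {0..2 * t} f + integral {2 * t..pi} f"
      using ord t by (intro Henstock_Kurzweil_Integration.integral_combine[symmetric] int) auto
    also have "integral {0..2 * t} f = integral {0..3/5 * t} f + integral {3/5 * t..2 * t} f"
      using ord t by (intro Henstock_Kurzweil_Integration.integral_combine[symmetric] int) auto
    also have "integral {0..3/5 * t} f = integral {0..5/3 * \<tau>} f + integral {5/3 * \<tau>..3/5 * t} f"
      using ord t \<tau>_le \<tau> by (intro Henstock_Kurzweil_Integration.integral_combine[symmetric] int) auto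
    also have "integral {0..5/3 * \<tau>} f = integral {0..3/2 * \<tau>} f + integral {3/2 * \<tau>..5/3 * \<tau>} f"
      using ord t \<tau>_le \<tau> by (intro Henstock_Kurzweil_Integration.integral_combine[symmetric] int) auto
    finally show ?thesis .
  qed

  \<comment> \<open>Since \<open>t ^ 4 * q = \<tau> ^ 3\<close>, a fifth power of \<open>t\<close>
    is comparable with \<open>\<tau> ^ 3\<close>. The exponents 2 and 5 in \<open>e2\<close> and
    \<open>e3\<close> are chosen to reach it, as the piece \<open>D\<close> already carries
    \<open>t ^ 3\<close>.\<close>
  have q9: "t ^ 5 \<le> 1826/10000 * \<tau> ^ 3"
  proof -
    have "t ^ 5 = t ^ 4 * q * q" using q by (simp add: power_numeral_reduce)
    also have "\<dots> \<le> \<tau> ^ 3 * (1826/10000)"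
      unfolding \<tau>(4) using q_le q t by (intro mult_left_mono) auto
    finally show ?thesis by simp
  qed
  have e1: "exp (- (5/2) :: real) \<le> 822/10000"
    by (rule exp_neg_le[of _ "1039825/1000000" "13667/10000"]) (simp_all add: power_divide)
  have e2: "exp (- (81/250 / t)) \<le> 63/1000000 * (30 * t) ^ 2"
  proof -
    have "exp (- (81/250 / t)) \<le> exp (- (30 * (81/250))) * (30 * t) ^ 2"
      by (rule exp_decay_power) (use t in auto)
    also have "exp (- (30 * (81/250))) * (30 * t) ^ 2 \<le> 63/1000000 * (30 * t) ^ 2"
    proof (rule mult_right_mono)
      show "exp (- (30 * (81/250)) :: real) \<le> 63/1000000"
      by (rule exp_neg_le[of _ "11634/10000" "3355/1000"]) (simp_all add: power_divide)
    qed simp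
    finally show ?thesis .
  qed
  have e3: "exp (- (199/250 / t)) \<le> 1/10000000000 * (30 * t) ^ 5"
  proof -
    have "exp (- (199/250 / t)) \<le> exp (- (30 * (199/250))) * (30 * t) ^ 5"
      by (rule exp_decay_power) (use t in auto)
    also have "exp (- (30 * (199/250))) * (30 * t) ^ 5 \<le> 1/10000000000 * (30 * t) ^ 5"
    proof (rule mult_right_mono)
      show "exp (- (30 * (199/250)) :: real) \<le> 1/10000000000"
      by (rule exp_neg_le[of _ "14427/10000" "187/10"]) (simp_all add: power_divide)
    qed (use t in simp)
    finally show ?thesis .
  qed
  let ?T = "\<tau> ^ 3"
  have T: "0 < ?T" using \<tau>(1) by simp
  have C1: "E / 2 * ?T * (10/9 * exp (- (5/2))) \<le> 4614/100000 * ?T"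
  proof -
    have "E * exp (- (5/2)) \<le> 10101/10000 * (822/10000)" using E e1 by (intro mult_mono) auto
    then have "E * exp (- (5/2)) * (5/9 * ?T) \<le> 10101/10000 * (822/10000) * (5/9 * ?T)"
      using T by (intro mult_right_mono) auto
    then show ?thesis using T by (simp add: field_simps)
  qed
  have D1: "E * exp (- (81/250 / t)) * (4/3 * t ^ 3) \<le> 1396/100000 * ?T"
  proof -
    have "E * exp (- (81/250 / t)) \<le> 10101/10000 * (63/1000000 * (30 * t) ^ 2)"
      using E e2 by (intro mult_mono) auto
    then have "E * exp (- (81/250 / t)) * (4/3 * t ^ 3) \<le> 10101/10000 * (63/1000000 * (30 * t) ^ 2) * (4/3 * t ^ 3)"
      using t by (intro mult_right_mono) auto
    also have "\<dots> = 10101/10000 * (63/1000000 * 900) * (4/3) * t ^ 5"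
      by (simp add: power_mult_distrib power_numeral_reduce)
    also have "\<dots> \<le> 10101/10000 * (63/1000000 * 900) * (4/3) * (1826/10000 * ?T)"
      using q9 by (intro mult_left_mono) auto
    also have "\<dots> \<le> 1396/100000 * ?T" using T by simp
    finally show ?thesis .
  qed
  have E1: "E * exp (- (199/250 / t)) * (2 * pi) \<le> 300/100000 * ?T"
  proof -
    have "E * exp (- (199/250 / t)) \<le> 10101/10000 * (1/10000000000 * (30 * t) ^ 5)"
      using E e3 by (intro mult_mono) auto
    then have "E * exp (- (199/250 / t)) * (2 * pi) \<le> 10101/10000 * (1/10000000000 * (30 * t) ^ 5) * (2 * (315/100))"
      by (rule mult_mono) (use t pi_approx in auto)
    also have "\<dots> = 10101/10000 * (24300000/10000000000) * (63/10) * t ^ 5"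
      by (simp add: power_mult_distrib)
    also have "\<dots> \<le> 10101/10000 * (24300000/10000000000) * (63/10) * (1826/10000 * ?T)"
      using q9 by (intro mult_left_mono) auto
    also have "\<dots> \<le> 300/100000 * ?T" using T by simp
    finally show ?thesis .
  qed
  have "0 < 999/2000 * ?T * (1365/10000) - 4614/100000 * ?T - 1396/100000 * ?T - 300/100000 * ?T"
    using T by simp
  also have "\<dots> \<le> integral {0..pi} f"
    unfolding split using A B C D E' C1 D1 E1 by linarith
  finally show ?thesis unfolding f_def .
qed

section \<open>Log-concavity for large arguments\<close>

lemma cos_int_has_integral:
  "((\<lambda>a. cos (of_int j * a)) has_integral (if j = 0 then pi else 0)) {0..pi}"
proof (cases "j = 0")
  case True
  then show ?thesis using has_integral_const_real[of "1::real" 0 pi] by simp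
next
  case False
  have "((\<lambda>a. cos (of_int j * a)) has_integral (sin (of_int j * pi) / of_int j - sin (of_int j * 0) / of_int j)) {0..pi}"
  proof (rule fundamental_theorem_of_calculus)
    fix x :: real
    have "((\<lambda>a. sin (of_int j * a) / of_int j) has_real_derivative cos (of_int j * x)) (at x)"
      using False by (auto intro!: derivative_eq_intros)
    then have "((\<lambda>a. sin (of_int j * a) / of_int j) has_real_derivative cos (of_int j * x)) (at x within {0..pi})"
      by (rule has_field_derivative_at_within)
    then show "((\<lambda>a. sin (of_int j * a) / of_int j) has_vector_derivative cos (of_int j * x)) (at x within {0..pi})"
      by (simp only: has_real_derivative_iff_has_vector_derivative)
  qed simp
  moreover have "sin (of_int j * pi) = 0" by (simp add: mult.commute)
  ultimately show ?thesis using False by simp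
qed

lemma fejer_has_integral:
  "((\<lambda>a. cos (of_int j * a) * (1 - cos a)) has_integral
      ((if j = 0 then pi else 0) - ((if j = -1 then pi else 0) + (if j = 1 then pi else 0)) / 2)) {0..pi}"
proof -
  have "((\<lambda>a. cos (of_int j * a) - (cos (of_int (j + 1) * a) + cos (of_int (j - 1) * a)) / 2) has_integral
      ((if j = 0 then pi else 0) - ((if j + 1 = 0 then pi else 0) + (if j - 1 = 0 then pi else 0)) / 2)) {0..pi}"
    by (intro has_integral_diff has_integral_divide has_integral_add cos_int_has_integral)
  moreover have "cos (of_int j * a) - (cos (of_int (j + 1) * a) + cos (of_int (j - 1) * a)) / 2
      = cos (of_int j * a) * (1 - cos a)" for a :: real
  proof -
    have "of_int (j + 1) * a = of_int j * a + a" "of_int (j - 1) * a = of_int j * a - a"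
      by (simp_all add: algebra_simps)
    then have "cos (of_int (j + 1) * a) + cos (of_int (j - 1) * a) = 2 * (cos (of_int j * a) * cos a)"
      by (simp only: cos_add cos_diff)
    then show ?thesis by (simp add: algebra_simps)
  qed
  moreover have "(j + 1 = 0) = (j = -1)" "(j - 1 = 0) = (j = 1)" by auto
  ultimately show ?thesis by simp
qed

text \<open>After multiplication by \<open>cis (- (real n * a))\<close> the k-th term has frequency
  \<open>k - n\<close>, and the weight \<open>1 - cos a\<close> retains only the frequencies -1, 0
  and 1. The Weierstrass test permits termwise integration.\<close>

lemma second_difference_integral:
  fixes c :: "nat \<Rightarrow> real" and F :: "complex \<Rightarrow> complex" and r :: real
  assumes r: "0 < r" and summ: "summable (\<lambda>k. \<bar>c k\<bar> * r ^ k)"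
    and F: "\<And>z. norm z = r \<Longrightarrow> (\<lambda>k. of_real (c k) * z ^ k) sums F z"
    and n: "1 \<le> n"
  shows "((\<lambda>a. Re (F (of_real r * cis a) * cis (- (real n * a))) * (1 - cos a)) has_integral
     pi * (c n * r ^ n - (c (n - 1) * r ^ (n - 1) + c (n + 1) * r ^ (n + 1)) / 2)) {0..pi}"
proof -
  define u where "u k a = c k * r ^ k * (cos (of_int (int k - int n) * a) * (1 - cos a))" for k a
  define g where "g a = Re (F (of_real r * cis a) * cis (- (real n * a))) * (1 - cos a)" for a
  define I where "I j = (if j = 0 then pi else 0) - ((if j = -1 then pi else 0) + (if j = 1 then pi else 0)) / 2"
    for j :: int
  have u_int: "(u k has_integral c k * r ^ k * I (int k - int n)) {0..pi}" for k
    unfolding u_def I_def by (intro has_integral_mult_right fejer_has_integral)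
  have u_sums: "(\<lambda>k. u k a) sums g a" for a
  proof -
    have "norm (of_real r * cis a) = r" using r by (simp add: norm_mult)
    from sums_mult2[OF F[OF this], of "cis (- (real n * a))"]
    have "(\<lambda>k. Re (of_real (c k) * (of_real r * cis a) ^ k * cis (- (real n * a)))) sums
        Re (F (of_real r * cis a) * cis (- (real n * a)))"
      by (rule sums_Re)
    moreover have "Re (of_real (c k) * (of_real r * cis a) ^ k * cis (- (real n * a))) =
        c k * r ^ k * cos (of_int (int k - int n) * a)" for k
    proof -
      have "of_real (c k) * (of_real r * cis a) ^ k * cis (- (real n * a)) =
          of_real (c k * r ^ k) * (cis (real k * a) * cis (- (real n * a)))"
        by (simp add: power_mult_distrib Complex.DeMoivre mult.assoc)
      also have "cis (real k * a) * cis (- (real n * a)) = cis (of_int (int k - int n) * a)"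
        by (simp add: cis_mult algebra_simps)
      finally show ?thesis by (simp only:) (simp only: scaleR_conv_of_real[symmetric] complex.sel scaleR_complex.sel cis.sel)
    qed
    ultimately have "(\<lambda>k. c k * r ^ k * cos (of_int (int k - int n) * a)) sums
        Re (F (of_real r * cis a) * cis (- (real n * a)))"
      by simp
    from sums_mult2[OF this, of "1 - cos a"] show ?thesis
      unfolding u_def g_def by (simp only: mult.assoc)
  qed
  have "uniform_limit {0..pi} (\<lambda>N a. \<Sum>k<N. u k a) (\<lambda>a. suminf (\<lambda>k. u k a)) sequentially"
  proof (rule Weierstrass_m_test)
    show "summable (\<lambda>k. 2 * (\<bar>c k\<bar> * r ^ k))" using summ by (rule summable_mult)
    fix k a assume "a \<in> {0..pi}"
    have "\<bar>cos (of_int (int k - int n) * a) * (1 - cos a)\<bar> \<le> 1 * 2"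
      unfolding abs_mult
    proof (rule mult_mono)
      show "\<bar>1 - cos a\<bar> \<le> 2"
        using cos_ge_minus_one[of a] cos_le_one[of a] by linarith
    qed auto
    then have "\<bar>c k\<bar> * r ^ k * \<bar>cos (of_int (int k - int n) * a) * (1 - cos a)\<bar> \<le> \<bar>c k\<bar> * r ^ k * 2"
      using r by (intro mult_left_mono) auto
    then show "norm (u k a) \<le> 2 * (\<bar>c k\<bar> * r ^ k)"
      using r by (simp add: u_def abs_mult)
  qed
  also have "(\<lambda>a. suminf (\<lambda>k. u k a)) = g"
    using u_sums by (auto simp: sums_iff)
  finally have ul: "uniform_limit {0..pi} (\<lambda>N a. \<Sum>k<N. u k a) g sequentially" .
  have "continuous_on {0..pi} (\<lambda>a. \<Sum>k<N. u k a)" for N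
    unfolding u_def by (intro continuous_intros)
  then obtain I' J where I': "\<And>N. ((\<lambda>a. \<Sum>k<N. u k a) has_integral I' N) {0..pi}"
    and J: "(g has_integral J) {0..pi}" and lim: "I' \<longlonglongrightarrow> J"
    using uniform_limit_integral[OF ul] by (metis sequentially_bot)
  have I'_eq: "I' N = (\<Sum>k<N. c k * r ^ k * I (int k - int n))" for N
    using I'[of N] has_integral_sum[of "{..<N}" u, OF _ u_int] has_integral_unique by blast
  let ?J = "pi * (c n * r ^ n - (c (n - 1) * r ^ (n - 1) + c (n + 1) * r ^ (n + 1)) / 2)"
  \<comment> \<open>From here on the partial sum contains all three surviving indices
    \<open>n - 1\<close>, \<open>n\<close>, \<open>n + 1\<close>, so the sequence of integrals is
    constant.\<close>
  have "I' N = ?J" if "n + 2 \<le> N" for N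
  proof -
    have "I' N = (\<Sum>k\<in>{n - 1, n, n + 1}. c k * r ^ k * I (int k - int n))"
      unfolding I'_eq by (rule sum.mono_neutral_right) (use that n in \<open>auto simp: I_def\<close>)
    also have "\<dots> = c (n - 1) * r ^ (n - 1) * I (-1) + (c n * r ^ n * I 0 + c (n + 1) * r ^ (n + 1) * I 1)"
    proof -
      obtain p where "n = Suc p" using n by (cases n) auto
      then show ?thesis by simp
    qed
    also have "\<dots> = ?J" by (simp add: I_def algebra_simps add_divide_distrib)
    finally show ?thesis .
  qed
  then have "I' \<longlonglongrightarrow> ?J"
    by (intro tendsto_eventually eventually_sequentiallyI)
  with lim have "J = ?J" by (rule LIMSEQ_unique)
  with J show ?thesis unfolding g_def by simp
qed

section \<open>Damping and phase of the whole product\<close>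

definition total_damp :: "nat \<Rightarrow> real \<Rightarrow> real \<Rightarrow> real" where
  "total_damp M r a = (\<Sum>j=1..M. damp (r ^ j) (real j * a))"

definition total_phase :: "nat \<Rightarrow> real \<Rightarrow> real \<Rightarrow> real" where
  "total_phase M r a = (\<Sum>j=1..M. phase (r ^ j) (real j * a))"

lemma power_in_unit_interval:
  fixes r :: real
  assumes "0 < r" "r < 1" "1 \<le> j"
  shows "0 \<le> r ^ j" "r ^ j < 1"
  using assms by (auto simp: power_less_one_iff)

lemma euler_product_polar:
  assumes r: "0 < r" "r < 1"
  shows "(\<Prod>j=1..M. 1 / (1 - (of_real r * cis a) ^ j)) =
     of_real (\<Prod>j=1..M. 1 / (1 - r ^ j)) * (of_real (exp (- total_damp M r a)) * cis (total_phase M r a))"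
proof (induction M)
  case 0
  then show ?case by (simp add: total_damp_def total_phase_def)
next
  case (Suc M)
  have prod_c: "(\<Prod>j=1..Suc M. g j) = g (Suc M) * (\<Prod>j=1..M. g j)" for g :: "nat \<Rightarrow> complex"
    by (simp add: mult.commute)
  have prod_r: "(\<Prod>j=1..Suc M. g j) = g (Suc M) * (\<Prod>j=1..M. g j)" for g :: "nat \<Rightarrow> real"
    by (simp add: mult.commute)
  have z: "(of_real r * cis a) ^ Suc M = of_real (r ^ Suc M) * cis (real (Suc M) * a)"
    by (simp only: power_mult_distrib Complex.DeMoivre of_real_power)
  have "1 / (1 - (of_real r * cis a) ^ Suc M) = of_real (1 / (1 - r ^ Suc M)) *
     (of_real (exp (- damp (r ^ Suc M) (real (Suc M) * a))) * cis (phase (r ^ Suc M) (real (Suc M) * a)))"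
    unfolding z by (rule geometric_factor_polar) (use power_in_unit_interval[OF r, of "Suc M"] in auto)
  moreover have "total_damp M r a + damp (r ^ Suc M) (real (Suc M) * a) = total_damp (Suc M) r a"
    "total_phase M r a + phase (r ^ Suc M) (real (Suc M) * a) = total_phase (Suc M) r a"
    by (simp_all add: total_damp_def total_phase_def)
  then have "exp (- total_damp (Suc M) r a) = exp (- total_damp M r a) * exp (- damp (r ^ Suc M) (real (Suc M) * a))"
    "cis (total_phase (Suc M) r a) = cis (total_phase M r a) * cis (phase (r ^ Suc M) (real (Suc M) * a))"
    by (metis exp_add minus_add_distrib) (metis cis_mult \<open>total_phase M r a + _ = _\<close>)
  ultimately show ?case
    using Suc by (simp only: prod_c prod_r of_real_mult mult_ac)
qed

lemma continuous_on_damp_phase: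
  assumes x: "0 \<le> x" "x < 1"
  shows "continuous_on S (\<lambda>a. damp x (c * a))" "continuous_on S (\<lambda>a. phase x (c * a))"
proof -
  \<comment> \<open>A positive real part keeps the argument off the branch cut of
    \<open>Ln\<close>.\<close>
  have nz: "1 - of_real x * cis (c * a) \<notin> \<real>\<^sub>\<le>\<^sub>0" for a
  proof -
    have "x * cos (c * a) \<le> x * 1" using x by (intro mult_left_mono) auto
    then have "Re (1 - of_real x * cis (c * a)) > 0" using x by simp
    then show ?thesis by (auto simp: complex_nonpos_Reals_iff)
  qed
  have L: "continuous_on S (\<lambda>a. Ln (1 - of_real x * cis (c * a)))"
    by (intro continuous_intros nz)
  show "continuous_on S (\<lambda>a. damp x (c * a))"
    unfolding damp_def by (intro continuous_on_diff continuous_on_Re L continuous_on_const)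
  show "continuous_on S (\<lambda>a. phase x (c * a))"
    unfolding phase_def by (intro continuous_on_minus continuous_on_Im L)
qed

lemma continuous_on_total:
  assumes r: "0 < r" "r < 1"
  shows "continuous_on S (total_damp M r)" "continuous_on S (total_phase M r)"
  unfolding total_damp_def total_phase_def
  by (intro continuous_on_sum continuous_on_damp_phase; use power_in_unit_interval[OF r] in simp)+

text \<open>Quadratic bounds for the factors add up to half the variance times
  \<open>a\<^sup>2\<close>; 329/200 is just above \<open>pi\<^sup>2 / 6\<close>.\<close>

lemma total_damp_le:
  assumes t: "0 < t"
  shows "total_damp M (exp (-t)) a \<le> 329/200 * a\<^sup>2 / t ^ 3"
proof -
  let ?r = "exp (-t)"
  have r: "0 < ?r" "?r < 1" using t by auto
  have "total_damp M ?r a \<le> (\<Sum>j=1..M. (real j * a)\<^sup>2 / 2 * (?r ^ j / (1 - ?r ^ j)\<^sup>2))"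
    unfolding total_damp_def by (intro sum_mono damp_le power_in_unit_interval[OF r]) auto
  also have "\<dots> = a\<^sup>2 / 2 * (\<Sum>j=1..M. real j ^ 2 * (?r ^ j / (1 - ?r ^ j)\<^sup>2))"
    unfolding sum_distrib_left by (rule sum.cong) (auto simp: power_mult_distrib)
  also have "\<dots> \<le> a\<^sup>2 / 2 * ((2 / t ^ 3) * (pi\<^sup>2 / 6))"
    by (intro mult_left_mono variance_bound[OF t]) auto
  also have "\<dots> = pi\<^sup>2 / 6 * (a\<^sup>2 / t ^ 3)" by simp
  also have "\<dots> \<le> 329/200 * (a\<^sup>2 / t ^ 3)"
  proof (rule mult_right_mono)
    have "pi\<^sup>2 \<le> (314160/100000)\<^sup>2" using pi_approx by (intro power_mono) auto
    then show "pi\<^sup>2 / 6 \<le> 329/200" by (simp add: power2_eq_square)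
  qed (use t in auto)
  finally show ?thesis by simp
qed

text \<open>The saddle point equation \<open>mean\<close> makes the linear terms sum to
  \<open>n * a\<close>. The cubic remainder is governed by the third cumulant, and 181/100 is just
  above \<open>11/60 * pi\<^sup>2\<close>.\<close>

lemma total_phase_diff_le:
  assumes t: "0 < t" and a: "0 \<le> a"
    and mean: "(\<Sum>j=1..M. real j * (exp (-t) ^ j / (1 - exp (-t) ^ j))) = n"
  shows "\<bar>total_phase M (exp (-t)) a - n * a\<bar> \<le> 181/100 * a ^ 3 / t ^ 4"
proof -
  let ?r = "exp (-t)"
  have r: "0 < ?r" "?r < 1" using t by auto
  have eq: "total_phase M ?r a - n * a =
      (\<Sum>j=1..M. phase (?r ^ j) (real j * a) - real j * a * (?r ^ j / (1 - ?r ^ j)))"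
    unfolding total_phase_def mean[symmetric] sum_distrib_right sum_subtractf
    by (simp add: mult_ac)
  have "\<bar>total_phase M ?r a - n * a\<bar> \<le>
      (\<Sum>j=1..M. \<bar>real j * a\<bar> ^ 3 / 6 * (?r ^ j * (1 + ?r ^ j) / (1 - ?r ^ j) ^ 3))"
    unfolding eq by (intro order_trans[OF sum_abs] sum_mono phase_diff_le power_in_unit_interval[OF r]) auto
  also have "\<dots> = a ^ 3 / 6 * (\<Sum>j=1..M. real j ^ 3 * (?r ^ j * (1 + ?r ^ j) / (1 - ?r ^ j) ^ 3))"
    unfolding sum_distrib_left by (rule sum.cong) (use a in \<open>auto simp: power_mult_distrib abs_mult\<close>)
  also have "\<dots> \<le> a ^ 3 / 6 * (((33/5) / t ^ 4) * (pi\<^sup>2 / 6))"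
    using a by (intro mult_left_mono third_moment_bound[OF t]) auto
  also have "\<dots> = 11/60 * pi\<^sup>2 * (a ^ 3 / t ^ 4)" by simp
  also have "\<dots> \<le> 181/100 * (a ^ 3 / t ^ 4)"
  proof (rule mult_right_mono)
    have "pi\<^sup>2 \<le> (314160/100000)\<^sup>2" using pi_approx by (intro power_mono) auto
    then show "11/60 * pi\<^sup>2 \<le> 181/100" by (simp add: power2_eq_square)
  qed (use t a in auto)
  finally show ?thesis by simp
qed

text \<open>Truncating the two kernels at \<open>M\<close> costs \<open>2 + 2/2 = 3\<close> times
  the tail of the geometric series; \<open>tail\<close> bounds this loss by 1/100.\<close>

lemma total_damp_ge:
  assumes t: "0 < t" and tail: "3 * exp (-t) ^ (M + 1) / (1 - exp (-t)) \<le> 1/100"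
  shows "kern (exp (-t)) a + kern (exp (- (2 * t))) (2 * a) / 2 - 1/100 \<le> total_damp M (exp (-t)) a"
proof -
  let ?r = "exp (-t)"
  have r: "0 < ?r" "?r < 1" using t by auto
  have r2: "?r ^ 2 = exp (- (2 * t))" by (simp flip: exp_of_nat_mult)
  have r2': "0 \<le> ?r ^ 2" "?r ^ 2 < 1" using power_in_unit_interval[OF r, of 2] by auto
  have 1: "kern ?r a - 2 * ?r ^ (M + 1) / (1 - ?r) \<le> (\<Sum>j=1..M. ?r ^ j * (1 - cos (real j * a)))"
    using r by (intro kern_partial) auto
  have 2: "kern (?r ^ 2) (2 * a) - 2 * (?r ^ 2) ^ (M + 1) / (1 - ?r ^ 2) \<le>
      (\<Sum>j=1..M. (?r ^ 2) ^ j * (1 - cos (real j * (2 * a))))"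
    by (rule kern_partial[OF r2'])
  have "(?r ^ 2) ^ (M + 1) / (1 - ?r ^ 2) \<le> ?r ^ (M + 1) / (1 - ?r)"
  proof (rule frac_le)
    show "(?r ^ 2) ^ (M + 1) \<le> ?r ^ (M + 1)"
      using r by (intro power_mono) (auto simp: power2_eq_square mult_le_one)
    show "1 - ?r \<le> 1 - ?r ^ 2"
      using r by (auto simp: power2_eq_square mult_le_one)
  qed (use r in auto)
  moreover have fracs: "3 * p / d = 3 * (p / d)" "2 * p / d / 2 = p / d" "2 * p / d = 2 * (p / d)" for p d :: real
    by simp_all
  ultimately have tails: "2 * ?r ^ (M + 1) / (1 - ?r) + 2 * (?r ^ 2) ^ (M + 1) / (1 - ?r ^ 2) / 2 \<le> 1/100"
    using tail by (simp only: fracs)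
  have "(\<Sum>j=1..M. ?r ^ j * (1 - cos (real j * a))) + (\<Sum>j=1..M. (?r ^ 2) ^ j * (1 - cos (real j * (2 * a)))) / 2
     = (\<Sum>j=1..M. ?r ^ j * (1 - cos (real j * a)) + (?r ^ j)\<^sup>2 * (1 - cos (2 * (real j * a))) / 2)"
    unfolding sum.distrib sum_divide_distrib
    by (intro arg_cong2[where f = "(+)"] sum.cong refl)
       (simp add: mult_ac power_mult[symmetric])
  also have "\<dots> \<le> total_damp M ?r a"
    unfolding total_damp_def by (intro sum_mono damp_ge power_in_unit_interval[OF r]) auto
  finally have 3: "(\<Sum>j=1..M. ?r ^ j * (1 - cos (real j * a))) +
      (\<Sum>j=1..M. (?r ^ 2) ^ j * (1 - cos (real j * (2 * a)))) / 2 \<le> total_damp M ?r a" .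
  have "k1 + k2 / 2 - 1/100 \<le> T"
    if "k1 - e1 \<le> s1" "k2 - e2 \<le> s2" "e1 + e2 / 2 \<le> 1/100" "s1 + s2 / 2 \<le> T"
    for k1 k2 e1 e2 s1 s2 T :: real
    using that by linarith
  from this[OF 1 2 tails 3] show ?thesis unfolding r2 .
qed

text \<open>Both kernels see the same \<open>u = a / t\<close>, and together they give the factor
  \<open>1 / t + 1 / (2 * (2 * t)) = 5/4 / t\<close>. The constants come from evaluating
  \<open>u\<^sup>2 / (51/50 + u\<^sup>2)\<close> or \<open>1 / (51/50 + u\<^sup>2)\<close> at the
  cut points \<open>u = 3/5\<close> and \<open>u = 2\<close>.\<close>

lemma total_damp_ge_regions:
  assumes t: "0 < t" "t \<le> 1/30" and tail: "3 * exp (-t) ^ (M + 1) / (1 - exp (-t)) \<le> 1/100"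
  shows "0 \<le> a \<Longrightarrow> a \<le> 3/5 * t \<Longrightarrow> 9/10 * a\<^sup>2 / t ^ 3 - 1/100 \<le> total_damp M (exp (-t)) a"
    and "3/5 * t \<le> a \<Longrightarrow> a \<le> 2 * t \<Longrightarrow> 81/250 / t - 1/100 \<le> total_damp M (exp (-t)) a"
    and "2 * t \<le> a \<Longrightarrow> a \<le> pi \<Longrightarrow> 199/250 / t - 1/100 \<le> total_damp M (exp (-t)) a"
proof -
  let ?R = "total_damp M (exp (-t)) a"
  have near: "5/4 / t * (u\<^sup>2 / (51/50 + u\<^sup>2)) - 1/100 \<le> ?R" if u: "0 \<le> u" "u \<le> 2" "a = u * t" for u
  proof -
    define W where "W = 1 / t * (u\<^sup>2 / (51/50 + u\<^sup>2))"
    have "W \<le> kern (exp (-t)) a"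
      unfolding W_def by (rule kern_exp_ge) (use t u in auto)
    moreover have "1 / (2 * t) * (u\<^sup>2 / (51/50 + u\<^sup>2)) \<le> kern (exp (- (2 * t))) (2 * a)"
      by (rule kern_exp_ge) (use t u in \<open>auto simp: mult_ac\<close>)
    then have "1/2 * W \<le> kern (exp (- (2 * t))) (2 * a)"
      by (simp add: W_def)
    ultimately have "5/4 * W - 1/100 \<le> ?R" using total_damp_ge[OF t(1) tail, of a] by linarith
    then show ?thesis by (simp add: W_def)
  qed
  {
    assume a: "0 \<le> a" "a \<le> 3/5 * t"
    define u where "u = a / t"
    have u: "0 \<le> u" "u \<le> 3/5" "a = u * t" using a t by (auto simp: u_def field_simps)
    have u2: "u\<^sup>2 \<le> (3/5)\<^sup>2" using u by (intro power_mono) auto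
    have "9/10 * a\<^sup>2 / t ^ 3 = 5/4 / t * (u\<^sup>2 * (18/25))"
      using t by (simp add: u(3) power_mult_distrib power2_eq_square power3_eq_cube)
    also have "\<dots> \<le> 5/4 / t * (u\<^sup>2 / (51/50 + u\<^sup>2))"
    proof (rule mult_left_mono)
      have "u\<^sup>2 * (18/25) * (51/50 + u\<^sup>2) \<le> u\<^sup>2 * (18/25) * (51/50 + (3/5)\<^sup>2)"
        using u2 by (intro mult_left_mono) auto
      also have "\<dots> \<le> u\<^sup>2" by (simp add: power2_eq_square)
      finally show "u\<^sup>2 * (18/25) \<le> u\<^sup>2 / (51/50 + u\<^sup>2)"
        by (subst pos_le_divide_eq) (auto intro: add_pos_nonneg)
    qed (use t in auto)
    finally show "9/10 * a\<^sup>2 / t ^ 3 - 1/100 \<le> ?R" using near[of u] u by linarith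
  next
    assume a: "3/5 * t \<le> a" "a \<le> 2 * t"
    define u where "u = a / t"
    have u: "3/5 \<le> u" "u \<le> 2" "a = u * t" using a t by (auto simp: u_def field_simps)
    have u2: "(3/5)\<^sup>2 \<le> u\<^sup>2" using u by (intro power_mono) auto
    have "81/250 / t = 5/4 / t * (162/625)" by simp
    also have "\<dots> \<le> 5/4 / t * (u\<^sup>2 / (51/50 + u\<^sup>2))"
    proof (rule mult_left_mono)
      show "162/625 \<le> u\<^sup>2 / (51/50 + u\<^sup>2)"
        using u2 by (subst pos_le_divide_eq) (auto intro: add_pos_nonneg simp: power2_eq_square)
    qed (use t in auto)
    finally show "81/250 / t - 1/100 \<le> ?R" using near[of u] u by linarith
  next
    assume a: "2 * t \<le> a" "a \<le> pi"
    have "1 / t * (2\<^sup>2 / (51/50 + 2\<^sup>2)) \<le> kern (exp (-t)) a"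
      by (rule kern_exp_ge) (use t a in \<open>auto intro!: cos_monotone_0_pi_le\<close>)
    moreover have "199/250 / t \<le> 1 / t * (2\<^sup>2 / (51/50 + 2\<^sup>2))"
      using t by (simp add: field_simps)
    \<comment> \<open>Here \<open>2 * a\<close> may reach a full turn, where the second kernel
      vanishes; only its sign is used.\<close>
    moreover have "0 \<le> kern (exp (- (2 * t))) (2 * a)"
      unfolding kern_def using t by (intro divide_nonneg_nonneg mult_nonneg_nonneg add_nonneg_nonneg) auto
    ultimately show "199/250 / t - 1/100 \<le> ?R"
      using total_damp_ge[OF t(1) tail, of a] by linarith
  }
qed

text \<open>Intermediate value theorem: the sum is 0 at \<open>r = 0\<close>, and at
  \<open>n / (n + 1)\<close> its term for \<open>j = 1\<close> alone equals \<open>n\<close>. The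
  upper bound for \<open>r\<close> is independent of \<open>M\<close>, so \<open>M\<close> may be
  fixed before \<open>r\<close> is known.\<close>

lemma saddle_point_exists:
  fixes n :: nat
  assumes n: "0 < n" and M: "1 \<le> M"
  obtains r where "0 < r" "r \<le> real n / real (n + 1)"
    "(\<Sum>j=1..M. real j * (r ^ j / (1 - r ^ j))) = real n"
proof -
  define \<rho> where "\<rho> = real n / real (n + 1)"
  let ?m = "\<lambda>r::real. \<Sum>j=1..M. real j * (r ^ j / (1 - r ^ j))"
  have \<rho>: "0 < \<rho>" "\<rho> < 1" using n by (auto simp: \<rho>_def)
  have lt: "r ^ j < 1" if "0 \<le> r" "r \<le> \<rho>" "1 \<le> j" for r j
    using that \<rho> by (auto simp: power_less_one_iff)
  have zero: "?m 0 = 0"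
    by (intro sum.neutral) (auto simp: power_0_left)
  have "real n = \<rho> / (1 - \<rho>)" using n by (simp add: \<rho>_def field_simps)
  also have "\<dots> = (\<Sum>j=1..1. real j * (\<rho> ^ j / (1 - \<rho> ^ j)))" by simp
  also have "\<dots> \<le> ?m \<rho>"
    using M \<rho> lt[of \<rho>] by (intro sum_mono2) (auto intro!: mult_nonneg_nonneg divide_nonneg_nonneg simp: less_imp_le)
  finally have "real n \<le> ?m \<rho>" .
  moreover have "continuous_on {0..\<rho>} ?m"
    using lt by (intro continuous_intros) (fastforce simp: less_le)
  ultimately obtain r where r: "0 \<le> r" "r \<le> \<rho>" "?m r = real n"
    using IVT'[of ?m 0 "real n" \<rho>] \<rho> zero by auto
  have "r \<noteq> 0"
  proof
    assume "r = 0"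
    with r(3) zero n show False by simp
  qed
  with r(1) have "0 < r" by simp
  with r(2,3) show ?thesis by (intro that) (simp_all only: \<rho>_def)
qed

lemma part_log_concave_large:
  assumes n: "1481 \<le> n"
  shows "part (n - 1) * part (n + 1) < part n ^ 2"
proof -
  define \<rho> where "\<rho> = real n / real (n + 1)"
  have \<rho>: "0 < \<rho>" "\<rho> < 1" using n by (auto simp: \<rho>_def)
  \<comment> \<open>The factor 300 is 3 times 100 from \<open>tail\<close>; \<open>n + 1\<close>
    compensates for \<open>1 / (1 - r) \<le> n + 1\<close>.\<close>
  obtain N where N: "\<rho> ^ N < 1 / (300 * real (n + 1))"
    using real_arch_pow_inv[of "1 / (300 * real (n + 1))" \<rho>] \<rho> by auto
  \<comment> \<open>\<open>M \<ge> n + 1\<close> ensures that \<open>rpart M\<close> agrees with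
    \<open>part\<close> up to \<open>n + 1\<close>.\<close>
  define M where "M = max N (n + 1)"
  obtain r where r: "0 < r" "r \<le> \<rho>" and mean: "(\<Sum>j=1..M. real j * (r ^ j / (1 - r ^ j))) = real n"
    by (rule saddle_point_exists[of n M, folded \<rho>_def]) (use n in \<open>auto simp: M_def\<close>)
  have r1: "r < 1" using r \<rho> by simp
  define t where "t = - ln r"
  have t0: "0 < t" using r r1 by (simp add: t_def)
  have rt: "r = exp (-t)" using r by (simp add: t_def)
  have tail: "3 * exp (-t) ^ (M + 1) / (1 - exp (-t)) \<le> 1/100"
  proof -
    have "r ^ (M + 1) \<le> \<rho> ^ (M + 1)" using r by (intro power_mono) auto
    also have "\<dots> \<le> \<rho> ^ N" using \<rho> by (intro power_decreasing) (auto simp: M_def)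
    finally have "3 * r ^ (M + 1) \<le> 3 * (1 / (300 * real (n + 1)))" using N by linarith
    moreover have "1 / real (n + 1) \<le> 1 - r" using r by (simp add: \<rho>_def field_simps)
    ultimately have "3 * r ^ (M + 1) / (1 - r) \<le> (3 * (1 / (300 * real (n + 1)))) / (1 / real (n + 1))"
      using r by (intro frac_le) auto
    also have "\<dots> = 1/100" by simp
    finally show ?thesis by (simp only: rt)
  qed
  \<comment> \<open>From \<open>n \<le> pi\<^sup>2 / (6 * t\<^sup>2)\<close>: the threshold 1481 is
    the first integer above \<open>900 * pi\<^sup>2 / 6\<close>.\<close>
  have t30: "t \<le> 1/30"
  proof -
    have "real n \<le> (1 / t\<^sup>2) * (pi\<^sup>2 / 6)"
      using mean_bound[OF t0 rt, of M] mean by simp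
    then have "1481 \<le> (1 / t\<^sup>2) * (pi\<^sup>2 / 6)" using n by linarith
    then have "1481 * t\<^sup>2 \<le> pi\<^sup>2 / 6" using t0 by (simp add: field_simps)
    moreover have "pi\<^sup>2 \<le> (314160/100000)\<^sup>2" using pi_approx by (intro power_mono) auto
    ultimately have "t\<^sup>2 \<le> (1/30)\<^sup>2" by (simp add: power2_eq_square)
    then show ?thesis by (rule power2_le_imp_le) simp
  qed
  define P where "P = (\<Prod>j=1..M. 1 / (1 - r ^ j))"
  have P: "0 < P"
    unfolding P_def using r r1 by (intro prod_pos) (auto simp: power_less_one_iff)
  define q where "q k = real (rpart M k) * r ^ k" for k
  define \<phi> where "\<phi> a = total_phase M r a - real n * a" for a
  let ?f = "\<lambda>a. exp (- total_damp M r a) * cos (\<phi> a) * (1 - cos a)"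
  have pos: "0 < integral {0..pi} ?f"
  proof (rule saddle_integral_pos[OF t0 t30])
    show "continuous_on {0..pi} (total_damp M r)"
      by (rule continuous_on_total[OF r(1) r1])
    show "continuous_on {0..pi} \<phi>"
      unfolding \<phi>_def by (intro continuous_intros continuous_on_total[OF r(1) r1])
    show "total_damp M r a \<le> 329/200 * a\<^sup>2 / t ^ 3" for a
      unfolding rt by (rule total_damp_le[OF t0])
    show "\<bar>\<phi> a\<bar> \<le> 181/100 * a ^ 3 / t ^ 4" if "0 \<le> a" for a
      unfolding \<phi>_def rt by (rule total_phase_diff_le[OF t0 that mean[unfolded rt]])
    show "9/10 * a\<^sup>2 / t ^ 3 - 1/100 \<le> total_damp M r a" if "0 \<le> a" "a \<le> 3/5 * t" for a
      unfolding rt by (rule total_damp_ge_regions(1)[OF t0 t30 tail that])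
    show "81/250 / t - 1/100 \<le> total_damp M r a" if "3/5 * t \<le> a" "a \<le> 2 * t" for a
      unfolding rt by (rule total_damp_ge_regions(2)[OF t0 t30 tail that])
    show "199/250 / t - 1/100 \<le> total_damp M r a" if "2 * t \<le> a" "a \<le> pi" for a
      unfolding rt by (rule total_damp_ge_regions(3)[OF t0 t30 tail that])
  qed
  have "((\<lambda>a. P * ?f a) has_integral pi * (q n - (q (n - 1) + q (n + 1)) / 2)) {0..pi}"
  proof -
    have "((\<lambda>a. Re ((\<Prod>j=1..M. 1 / (1 - (of_real r * cis a) ^ j)) * cis (- (real n * a))) * (1 - cos a))
        has_integral pi * (q n - (q (n - 1) + q (n + 1)) / 2)) {0..pi}"
      unfolding q_def
    proof (rule second_difference_integral)
      show "summable (\<lambda>k. \<bar>real (rpart M k)\<bar> * r ^ k)"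
        using rpart_sums(1)[of "of_real r" M] r r1 by simp
      show "(\<lambda>k. of_real (real (rpart M k)) * z ^ k) sums (\<Prod>j=1..M. 1 / (1 - z ^ j))" if "norm z = r" for z :: complex
        using rpart_sums(2)[of z M] that r1 by simp
    qed (use r n in auto)
    moreover have "Re ((\<Prod>j=1..M. 1 / (1 - (of_real r * cis a) ^ j)) * cis (- (real n * a))) * (1 - cos a) = P * ?f a"
      for a
    proof -
      have "(\<Prod>j=1..M. 1 / (1 - (of_real r * cis a) ^ j)) * cis (- (real n * a)) =
          of_real (P * exp (- total_damp M r a)) * cis (\<phi> a)"
        unfolding euler_product_polar[OF r(1) r1] P_def[symmetric] \<phi>_def
        by (simp add: cis_mult mult.assoc)
      then show ?thesis by simp
    qed
    ultimately show ?thesis by (simp only:)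
  qed
  then have "integral {0..pi} (\<lambda>a. P * ?f a) = pi * (q n - (q (n - 1) + q (n + 1)) / 2)"
    by (rule integral_unique)
  then have "0 < pi * (q n - (q (n - 1) + q (n + 1)) / 2)"
    using mult_pos_pos[OF P pos] by (simp only: Henstock_Kurzweil_Integration.integral_mult_right)
  then have mid: "(q (n - 1) + q (n + 1)) / 2 < q n"
    using pi_gt_zero by (simp add: zero_less_mult_iff)
  \<comment> \<open>Arithmetic and geometric means. The weights then cancel, since the exponents
    \<open>n - 1\<close> and \<open>n + 1\<close> add up to \<open>2 * n\<close>.\<close>
  have "q (n - 1) * q (n + 1) \<le> ((q (n - 1) + q (n + 1)) / 2)\<^sup>2"
    using zero_le_power2[of "q (n - 1) - q (n + 1)"] by (simp add: power2_eq_square field_simps)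
  also have "\<dots> < (q n)\<^sup>2"
    using mid r by (intro power_strict_mono) (auto simp: q_def)
  finally have less: "q (n - 1) * q (n + 1) < (q n)\<^sup>2" .
  have q_eq: "q k = real (part k) * r ^ k" if "k \<le> n + 1" for k
    using that by (simp add: q_def M_def rpart_eq_part)
  have "(n - 1) + (n + 1) = n * 2" using n by simp
  then have pw: "r ^ (n - 1) * r ^ (n + 1) = (r ^ n)\<^sup>2"
    by (simp only: power_add[symmetric] power_mult)
  have q1: "q (n - 1) = real (part (n - 1)) * r ^ (n - 1)"
    and q2: "q (n + 1) = real (part (n + 1)) * r ^ (n + 1)"
    by (rule q_eq, simp)+
  have "q (n - 1) * q (n + 1) = real (part (n - 1)) * real (part (n + 1)) * (r ^ (n - 1) * r ^ (n + 1))"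
    unfolding q1 q2 by (simp only: mult_ac)
  moreover have "(q n)\<^sup>2 = (real (part n))\<^sup>2 * (r ^ n)\<^sup>2"
    by (subst q_eq) (simp_all add: power_mult_distrib)
  ultimately have "real (part (n - 1)) * real (part (n + 1)) * (r ^ n)\<^sup>2 < (real (part n))\<^sup>2 * (r ^ n)\<^sup>2"
    using less by (simp only: pw)
  then have "real (part (n - 1)) * real (part (n + 1)) < (real (part n))\<^sup>2"
    using r by (simp add: mult_less_cancel_right)
  then show ?thesis
    by (simp flip: of_nat_mult of_nat_power)
qed

theorem theorem5p1:
  fixes n m :: nat
  assumes "1 < m" and "m < n"
  shows "int (part n) ^ 2 - int (part (n - m)) * int (part (n + m)) > 0"
proof -
  have "part (n - 1) * part (n + 1) < part n ^ 2" if "26 \<le> n" for n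
    using part_log_concave_small[OF that] part_log_concave_large[of n] by linarith
  then have "part (n - m) * part (n + m) < part n ^ 2"
    using assms by (rule part_strong_log_concave)
  then have "int (part (n - m) * part (n + m)) < int (part n ^ 2)"
    by (simp only: of_nat_less_iff)
  then show ?thesis by simp
qed

end
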